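(* Let $(X,d,\mu)$ be a complete metric measure space with $\mu$ doubling, let $1<p<\infty$, assume that $X$ supports a $p$-Poincaré inequality, and let $Q>0$ be an order for which $X$ has relative lower volume decay. Let $0<\delta<\infty$, and let $u\in N^{1,p}(X)$ be defined pointwise everywhere by $$u(x)=\limsup_{r\to 0}\frac{1}{\mu(B(x,r))}\int_{B(x,r)}u\,d\mu ,\qquad x\in X.$$ Suppose that one of the following holds: $p<Q$ and $0<h\le\frac{Qp}{Q-p}$; or $p=Q$ and $h>0$; or $p>Q$ and $h>0$. If $\mu(X)<\infty$, then $$\int_X\left(\int_0^{\delta}\left(\frac{1}{\mu(B(x,r))}\int_{B(x,r)}|u-u(x)|^h\,d\mu\right)^{\frac{p}{h(p-1)}}\frac{dr}{r}\right)^{p-1}d\mu(x)<\infty .$$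
   Context: $X=(X,d,\mu)$ is a complete metric space with a positive Borel regular measure $\mu$ such that $0<\mu(B)<\infty$ for every open ball $B=B(x,r)$, and $\mu$ is doubling: there is $C_\mu>0$ with $\mu(2B)\le C_\mu\mu(B)$ for all balls $B$. Here $\sigma B$ denotes the ball with the same centre as $B$ and $\sigma$ times its radius. Relative lower volume decay of order $Q>0$: there is $C>0$ such that $\frac{\mu(B(y,r))}{\mu(B(x,R))}\ge C\left(\frac rR\right)^Q$ whenever $x\in X$, $y\in B(x,R)$ and $0<r\le R<\infty$. Curves are non-constant, compact and rectifiable, parameterized by arc length $ds$. A property holds for $p$-almost every curve if there is a non-negative Borel function $\rho\in L^p(X)$ with $\int_\gamma\rho\,ds=\infty$ for every curve $\gamma$ for which the property fails. A non-negative Borel function $g$ on $X$ is an upper gradient of $u:X\to\mathbb R$ if $|u(\gamma(0))-u(\gamma(l))|\le\int_\gamma g\,ds$ for all curves $\gamma:[0,l]\to X$; it is a $p$-weak upper gradient if this holds for $p$-almost every curve. $X$ supports a $p$-Poincaré inequality if there are constants $C>0$ and $\sigma\ge1$ such that for all balls $B\subset X$, all integrable functions $u$ on $X$ and all $p$-weak upper gradients $g$ of $u$, $\frac1{\mu(B)}\int_B|u-u_B|\,d\mu\le C\,\mathrm{diam}(B)\left(\frac1{\mu(\sigma B)}\int_{\sigma B}g^p\,d\mu\right)^{1/p}$, where $u_B=\frac1{\mu(B)}\int_Bu\,d\mu$. Newton-Sobolev space: $\tilde N^{1,p}(X)$ is the collection of everywhere-defined functions $u\in L^p(X)$ having an upper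 gradient in $L^p(X)$, with seminorm $\|u\|_{\tilde N^{1,p}(X)}=\left(\int_X|u|^p\,d\mu+\inf_g\int_Xg^p\,d\mu\right)^{1/p}$, the infimum being over all upper gradients $g$ of $u$; $N^{1,p}(X)=\tilde N^{1,p}(X)/\sim$, where $u\sim v$ iff $\|u-v\|_{\tilde N^{1,p}(X)}=0$, with the quotient norm. *)

theory Defs
  imports "HOL-Analysis.Analysis"
begin

text \<open>Powers of extended nonnegative numbers; only used with exponents \<open>a > 0\<close>.\<close>

definition epowr :: "ennreal \<Rightarrow> real \<Rightarrow> ennreal" where
  "epowr x a = (if x = \<infinity> then \<infinity> else ennreal (enn2real x powr a))"

text \<open>
  A positive Borel regular measure is represented by its restriction to its measurable sets:
  a complete measure, defined at least on the Borel sets, such that every measurable set has a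
  Borel superset of the same measure.
\<close>

definition metric_measure_space :: "'a::metric_space measure \<Rightarrow> bool" where
  "metric_measure_space M \<longleftrightarrow>
     space M = UNIV \<and> sets borel \<subseteq> sets M \<and> complete_measure M \<and>
     (\<forall>A\<in>sets M. \<exists>B\<in>sets borel. A \<subseteq> B \<and> emeasure M B = emeasure M A) \<and>
     (\<forall>x r. 0 < r \<longrightarrow> 0 < emeasure M (ball x r) \<and> emeasure M (ball x r) < \<infinity>)"

definition doubling_measure :: "'a::metric_space measure \<Rightarrow> bool" where
  "doubling_measure M \<longleftrightarrow>
     (\<exists>C>0. \<forall>x r. 0 < r \<longrightarrow> measure M (ball x (2 * r)) \<le> C * measure M (ball x r))"

definition relative_lower_volume_decay :: "'a::metric_space measure \<Rightarrow> real \<Rightarrow> bool" where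
  "relative_lower_volume_decay M Q \<longleftrightarrow>
     (\<exists>C>0. \<forall>x y r R. y \<in> ball x R \<longrightarrow> 0 < r \<longrightarrow> r \<le> R \<longrightarrow>
        measure M (ball y r) / measure M (ball x R) \<ge> C * (r / R) powr Q)"

definition curve_length :: "(real \<Rightarrow> 'a::metric_space) \<Rightarrow> real \<Rightarrow> real \<Rightarrow> ennreal" where
  "curve_length \<gamma> a b =
     (SUP (n, \<tau>) \<in> {(n :: nat, \<tau> :: nat \<Rightarrow> real). mono \<tau> \<and> range \<tau> \<subseteq> {a..b}}.
        ennreal (\<Sum>i<n. dist (\<gamma> (\<tau> i)) (\<gamma> (\<tau> (Suc i)))))"

text \<open>
  \<open>arc_length_curve \<gamma> l\<close>: a non-constant compact rectifiable curve on \<open>[0,l]\<close>, parameterized by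
  arc length; only the values of \<open>\<gamma>\<close> on \<open>[0,l]\<close> matter.
  The curve has length \<open>l\<close>, so it is non-constant iff \<open>l > 0\<close>.
\<close>

definition arc_length_curve :: "(real \<Rightarrow> 'a::metric_space) \<Rightarrow> real \<Rightarrow> bool" where
  "arc_length_curve \<gamma> l \<longleftrightarrow>
     0 < l \<and> continuous_on {0..l} \<gamma> \<and>
     (\<forall>s t. 0 \<le> s \<longrightarrow> s \<le> t \<longrightarrow> t \<le> l \<longrightarrow> curve_length \<gamma> s t = ennreal (t - s))"

definition curve_integral :: "(real \<Rightarrow> 'a) \<Rightarrow> real \<Rightarrow> ('a \<Rightarrow> ennreal) \<Rightarrow> ennreal" where
  "curve_integral \<gamma> l \<rho> = (\<integral>\<^sup>+t\<in>{0..l}. \<rho> (\<gamma> t) \<partial>lborel)"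

text \<open>As usual in this theory, nonnegative Borel functions may take the value \<open>\<infinity>\<close>.\<close>

definition almost_every_curve ::
    "'a::metric_space measure \<Rightarrow> real \<Rightarrow> ((real \<Rightarrow> 'a) \<Rightarrow> real \<Rightarrow> bool) \<Rightarrow> bool" where
  "almost_every_curve M p P \<longleftrightarrow>
     (\<exists>\<rho>\<in>borel_measurable borel. (\<integral>\<^sup>+x. epowr (\<rho> x) p \<partial>M) < \<infinity> \<and>
        (\<forall>\<gamma> l. arc_length_curve \<gamma> l \<longrightarrow> \<not> P \<gamma> l \<longrightarrow> curve_integral \<gamma> l \<rho> = \<infinity>))"

definition upper_gradient :: "('a::metric_space \<Rightarrow> real) \<Rightarrow> ('a \<Rightarrow> ennreal) \<Rightarrow> bool" where
  "upper_gradient u g \<longleftrightarrow>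
     g \<in> borel_measurable borel \<and>
     (\<forall>\<gamma> l. arc_length_curve \<gamma> l \<longrightarrow> ennreal \<bar>u (\<gamma> 0) - u (\<gamma> l)\<bar> \<le> curve_integral \<gamma> l g)"

definition weak_upper_gradient ::
    "'a::metric_space measure \<Rightarrow> real \<Rightarrow> ('a \<Rightarrow> real) \<Rightarrow> ('a \<Rightarrow> ennreal) \<Rightarrow> bool" where
  "weak_upper_gradient M p u g \<longleftrightarrow>
     g \<in> borel_measurable borel \<and>
     almost_every_curve M p (\<lambda>\<gamma> l. ennreal \<bar>u (\<gamma> 0) - u (\<gamma> l)\<bar> \<le> curve_integral \<gamma> l g)"

definition average :: "'a measure \<Rightarrow> 'a set \<Rightarrow> ('a \<Rightarrow> real) \<Rightarrow> real" where
  "average M B u = set_lebesgue_integral M B u / measure M B"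

definition nn_average :: "'a measure \<Rightarrow> 'a set \<Rightarrow> ('a \<Rightarrow> ennreal) \<Rightarrow> ennreal" where
  "nn_average M B f = (\<integral>\<^sup>+x\<in>B. f x \<partial>M) / emeasure M B"

definition supports_poincare :: "'a::metric_space measure \<Rightarrow> real \<Rightarrow> bool" where
  "supports_poincare M p \<longleftrightarrow>
     (\<exists>C>0. \<exists>\<sigma>\<ge>1. \<forall>x r u g. 0 < r \<longrightarrow> integrable M u \<longrightarrow> weak_upper_gradient M p u g \<longrightarrow>
        nn_average M (ball x r) (\<lambda>y. ennreal \<bar>u y - average M (ball x r) u\<bar>)
          \<le> ennreal (C * diameter (ball x r)) *
            epowr (nn_average M (ball x (\<sigma> * r)) (\<lambda>y. epowr (g y) p)) (1 / p))"

text \<open>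
  \<open>newton_functions\<close> is the space of everywhere defined functions, \<open>newton_space\<close> its quotient,
  whose elements are equivalence classes of functions.
\<close>

definition newton_functions :: "'a::metric_space measure \<Rightarrow> real \<Rightarrow> ('a \<Rightarrow> real) set" where
  "newton_functions M p =
     {u \<in> borel_measurable M. (\<integral>\<^sup>+x. ennreal (\<bar>u x\<bar> powr p) \<partial>M) < \<infinity> \<and>
        (\<exists>g. upper_gradient u g \<and> (\<integral>\<^sup>+x. epowr (g x) p \<partial>M) < \<infinity>)}"

definition newton_seminorm :: "'a::metric_space measure \<Rightarrow> real \<Rightarrow> ('a \<Rightarrow> real) \<Rightarrow> ennreal" where
  "newton_seminorm M p u =
     epowr ((\<integral>\<^sup>+x. ennreal (\<bar>u x\<bar> powr p) \<partial>M) +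
            (INF g\<in>{g. upper_gradient u g}. \<integral>\<^sup>+x. epowr (g x) p \<partial>M)) (1 / p)"

definition newton_rel ::
    "'a::metric_space measure \<Rightarrow> real \<Rightarrow> (('a \<Rightarrow> real) \<times> ('a \<Rightarrow> real)) set" where
  "newton_rel M p =
     {(u, v). u \<in> newton_functions M p \<and> v \<in> newton_functions M p \<and>
        newton_seminorm M p (\<lambda>x. u x - v x) = 0}"

definition newton_space :: "'a::metric_space measure \<Rightarrow> real \<Rightarrow> ('a \<Rightarrow> real) set set" where
  "newton_space M p = newton_functions M p // newton_rel M p"

text \<open>
  The pointwise limit superior of the averages. It may be infinite at some points, and it is
  the same for all representatives of a class in \<open>newton_space\<close>, since these agree almost
  everywhere.
\<close>

definition limsup_averages :: "'a::metric_space measure \<Rightarrow> ('a \<Rightarrow> real) \<Rightarrow> 'a \<Rightarrow> ereal" where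
  "limsup_averages M v x = Limsup (at_right 0) (\<lambda>r. ereal (average M (ball x r) v))"

end

theory Submission
  imports Defs
begin

text \<open>
  Enlarging \<open>Q\<close> if necessary we may assume \<open>p < Q\<close> and \<open>h \<le> q := Qp/(Q - p)\<close>. Fix an upper
  gradient \<open>g \<ge> 1\<close> in \<open>L\<^sup>p\<close> and let \<open>N\<close> be the finite measure with density \<open>g\<^sup>p\<close>.

  If \<open>w\<close> has the weak upper gradient \<open>g\<close> restricted to \<open>A\<close>, telescoping the averages of \<open>w\<close> over
  the balls of radius \<open>r/2\<^sup>j\<close> gives a weak type \<open>(q,p)\<close> estimate: at the large scales the volume
  decay bounds the differences by a geometric series, at the small scales the superlevel
  sets of the densities of \<open>N\<close> on \<open>A\<close> are controlled scale by scale. No maximal function is needed.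
  Applied to dyadic truncations of \<open>\<bar>v - a\<bar>\<close>, whose gradients live on disjoint sets, it becomes
  the Sobolev--Poincare inequality with the critical exponent \<open>q\<close>.

  Summed over a cover of the space by balls of radius \<open>r\<close> with bounded overlap, this inequality shows
  that \<open>\<bar>v - v(x)\<bar>\<^sup>h\<close>, averaged over \<open>B(x,r)\<close> and raised to the power \<open>p/h\<close>, has integral at most a
  constant times \<open>r\<^sup>p\<close>. Already the \<open>L\<^sup>1\<close> version of this bound makes almost every point a Lebesgue
  point, so that \<open>u = v\<close> almost everywhere without any covering theorem; in general the decay in
  \<open>r\<close> makes the dyadic sum over \<open>r = \<delta>/2\<^sup>k\<close> converge.
\<close>

section \<open>Powers and integrals\<close>

text \<open>The condition \<open>g \<ge> 1\<close> makes \<open>N\<close> dominate the given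
  measure, so \<open>N\<close> has density at least 1 on every ball. Energies are then positive,
  which allows rescaling by them, and a power \<open>s/p \<le> 1\<close> of a density is at most the
  density itself; this linear form can be summed over a cover of bounded overlap. Finite total
  measure forces the space to be bounded, so the covers are finite.

  The weak type estimate presupposes Lebesgue points of the truncations, hence of \<open>v\<close>.
  To avoid a circle these are obtained from the Poincare inequality with exponent 1, before the
  critical exponent is reached.

  In the last step let \<open>F\<^sub>k\<close> bound the oscillation at radii near
  \<open>\<delta>/2^k\<close>. Handling the outer power \<open>p - 1\<close> directly would depend
  on whether \<open>p \<le> 2\<close>. Bounding every \<open>F\<^sub>k\<close> by
  \<open>2^(-k) * W\<close>, with \<open>W\<close> the sum of all \<open>2^k * F\<^sub>k\<close>,
  makes the bound linear in \<open>W\<close>. The integral of \<open>W\<close> is still finite,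
  because \<open>2^k * (\<delta>/2^k)^p\<close> is geometric with ratio
  \<open>2^(1 - p) < 1\<close>.\<close>

lemma integrable_imp_set_integrable:
  fixes f :: "'a \<Rightarrow> real"
  assumes "integrable M f" "E \<in> sets M"
  shows "set_integrable M E f"
  unfolding set_integrable_def using assms by (rule integrable_mult_indicator[rotated])

lemma set_integral_mono_set:
  fixes f :: "'a \<Rightarrow> real"
  assumes "integrable M f" "A \<in> sets M" "B \<in> sets M" "A \<subseteq> B" "\<And>x. 0 \<le> f x"
  shows "(LINT x:A|M. f x) \<le> (LINT x:B|M. f x)"
  unfolding set_lebesgue_integral_def
  using assms by (intro integral_mono integrable_mult_indicator) (auto simp: indicator_def)

lemma nn_integral_set_eq_integral:
  fixes f :: "'a \<Rightarrow> real"
  assumes "integrable M f" "E \<in> sets M" "\<And>x. 0 \<le> f x"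
  shows "(\<integral>\<^sup>+x\<in>E. ennreal (f x) \<partial>M) = ennreal (LINT x:E|M. f x)"
proof -
  have "(\<integral>\<^sup>+x\<in>E. ennreal (f x) \<partial>M) = (\<integral>\<^sup>+x. ennreal (indicator E x *\<^sub>R f x) \<partial>M)"
    by (intro nn_integral_cong) (auto simp: indicator_def)
  also have "\<dots> = ennreal (LINT x:E|M. f x)"
    unfolding set_lebesgue_integral_def
    using assms by (intro nn_integral_eq_integral integrable_mult_indicator) (auto simp: indicator_def)
  finally show ?thesis .
qed

lemma powr_add_le:
  fixes a b h :: real
  assumes "0 \<le> a" "0 \<le> b" "0 < h"
  shows "(a + b) powr h \<le> 2 powr h * (a powr h + b powr h)"
proof -
  have "(a + b) powr h \<le> (2 * max a b) powr h" using assms by (intro powr_mono2) auto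
  also have "\<dots> = 2 powr h * (max a b) powr h" using assms by (simp add: powr_mult)
  also have "\<dots> \<le> 2 powr h * (a powr h + b powr h)"
    by (intro mult_left_mono) (auto simp: max_def)
  finally show ?thesis .
qed

lemma epowr_ennreal: "0 \<le> x \<Longrightarrow> epowr (ennreal x) a = ennreal (x powr a)"
  by (simp add: epowr_def)

lemma epowr_mono: "x \<le> y \<Longrightarrow> 0 \<le> a \<Longrightarrow> epowr x a \<le> epowr y a"
  by (auto simp: epowr_def top_unique less_top intro!: ennreal_leI powr_mono2 enn2real_mono)

lemma borel_measurable_epowr [measurable (raw)]:
  assumes "f \<in> borel_measurable M"
  shows "(\<lambda>x. epowr (f x) a) \<in> borel_measurable M"
  unfolding epowr_def using assms by measurable

text \<open>Integrate the multiplicity of the family, which is at most \<open>n\<close> on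
  \<open>D\<close> and zero outside it.\<close>

lemma sum_measure_overlap_le:
  assumes "finite_measure N" "finite S" "\<And>z. z \<in> S \<Longrightarrow> E z \<in> sets N" "D \<in> sets N"
    and "\<And>z. z \<in> S \<Longrightarrow> E z \<subseteq> D"
    and "\<And>x. real (card {z \<in> S. x \<in> E z}) \<le> n"
  shows "(\<Sum>z\<in>S. measure N (E z)) \<le> n * measure N D"
proof -
  interpret finite_measure N by fact
  have "(\<Sum>z\<in>S. measure N (E z)) = (\<integral>x. (\<Sum>z\<in>S. indicator (E z) x) \<partial>N)"
    using assms(2,3) by (subst Bochner_Integration.integral_sum) (auto simp: integrable_real_indicator less_top[symmetric])
  also have "\<dots> \<le> (\<integral>x. n * indicator D x \<partial>N)"
  proof (rule integral_mono)
    show "integrable N (\<lambda>x. \<Sum>z\<in>S. indicator (E z) x :: real)"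
      "integrable N (\<lambda>x. n * indicator D x :: real)"
      using assms(2-4) by (auto simp: integrable_real_indicator less_top[symmetric])
    fix x
    have *: "(\<Sum>z\<in>S. indicator (E z) x) = real (card {z \<in> S. x \<in> E z})"
      using assms(2) by (simp add: indicator_def sum.If_cases Int_def)
    show "(\<Sum>z\<in>S. indicator (E z) x) \<le> n * indicator D x"
    proof (cases "x \<in> D")
      case True then show ?thesis using * assms(6) by simp
    next
      case False
      then have "{z \<in> S. x \<in> E z} = {}" using assms(5) by auto
      then show ?thesis using * False by simp
    qed
  qed
  also have "\<dots> = n * measure N D" using assms(4) by simp
  finally show ?thesis .
qed

section \<open>Truncations along curves\<close>

lemma arc_length_curveD:
  assumes "arc_length_curve \<gamma> l"
  shows "0 < l" "continuous_on {0..l} \<gamma>"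
  using assms unfolding arc_length_curve_def by blast+

lemma upper_gradient_borel: "upper_gradient u g \<Longrightarrow> g \<in> borel_measurable borel"
  unfolding upper_gradient_def by blast

lemma curve_length_shift_le:
  "curve_length (\<lambda>t. \<gamma> (s + t)) a b \<le> curve_length \<gamma> (s + a) (s + b)"
  unfolding curve_length_def
proof (rule SUP_least, clarify)
  fix n and \<tau> :: "nat \<Rightarrow> real" assume "mono \<tau>" "range \<tau> \<subseteq> {a..b}"
  then have "(n, \<lambda>i. s + \<tau> i) \<in> {(n :: nat, \<tau> :: nat \<Rightarrow> real). mono \<tau> \<and> range \<tau> \<subseteq> {s + a..s + b}}"
    by (auto simp: mono_def)
  then show "ennreal (\<Sum>i<n. dist (\<gamma> (s + \<tau> i)) (\<gamma> (s + \<tau> (Suc i))))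
    \<le> (SUP (n, \<tau>) \<in> {(n :: nat, \<tau> :: nat \<Rightarrow> real). mono \<tau> \<and> range \<tau> \<subseteq> {s + a..s + b}}.
        ennreal (\<Sum>i<n. dist (\<gamma> (\<tau> i)) (\<gamma> (\<tau> (Suc i)))))"
    by (rule SUP_upper2) simp
qed

lemma curve_length_shift:
  "curve_length (\<lambda>t. \<gamma> (s + t)) a b = curve_length \<gamma> (s + a) (s + b)"
proof (rule antisym)
  show "curve_length \<gamma> (s + a) (s + b) \<le> curve_length (\<lambda>t. \<gamma> (s + t)) a b"
    using curve_length_shift_le[of "\<lambda>t. \<gamma> (s + t)" "- s" "s + a" "s + b"] by simp
qed (rule curve_length_shift_le)

lemma arc_length_subcurve:
  assumes "arc_length_curve \<gamma> l" "0 \<le> s" "s < t" "t \<le> l"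
  shows "arc_length_curve (\<lambda>x. \<gamma> (s + x)) (t - s)"
  unfolding arc_length_curve_def
proof (intro conjI allI impI)
  have "continuous_on {0..l} \<gamma>" by (rule arc_length_curveD[OF assms(1)])
  then show "continuous_on {0..t - s} (\<lambda>x. \<gamma> (s + x))"
    by (rule continuous_on_compose2) (use assms(2-4) in \<open>auto intro!: continuous_intros\<close>)
  show "curve_length (\<lambda>x. \<gamma> (s + x)) a b = ennreal (b - a)" if "0 \<le> a" "a \<le> b" "b \<le> t - s" for a b
  proof -
    have "curve_length (\<lambda>x. \<gamma> (s + x)) a b = curve_length \<gamma> (s + a) (s + b)"
      by (rule curve_length_shift)
    also have "\<dots> = ennreal ((s + b) - (s + a))"
    proof -
      have "0 \<le> s + a" "s + a \<le> s + b" "s + b \<le> l" using assms(2-4) that by auto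
      then show ?thesis using assms(1) unfolding arc_length_curve_def by blast
    qed
    finally show ?thesis by simp
  qed
  show "0 < t - s" using assms(3) by simp
qed

text \<open>\<open>\<gamma>\<close> is arbitrary outside \<open>{0..l}\<close>, so \<open>g\<close>
  along it need not be measurable on the whole line. Clamping the parameter to \<open>{0..l}\<close>
  gives a continuous curve on the line with the same values where they matter.\<close>

lemma borel_measurable_along_curve:
  fixes g :: "'a::metric_space \<Rightarrow> ennreal" and \<gamma> :: "real \<Rightarrow> 'a"
  assumes "continuous_on {0..l} \<gamma>" "0 \<le> l" "g \<in> borel_measurable borel"
  shows "(\<lambda>x. g (\<gamma> (max 0 (min l x)))) \<in> borel_measurable borel"
proof -
  have "continuous_on UNIV (\<lambda>x. \<gamma> (max 0 (min l x)))"
    using assms by (intro continuous_on_compose2[OF assms(1)] continuous_intros) auto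
  then have "(\<lambda>x. \<gamma> (max 0 (min l x))) \<in> borel_measurable borel"
    by (rule borel_measurable_continuous_onI)
  then show ?thesis using assms(3) by (rule measurable_compose)
qed

lemma curve_integral_subcurve:
  fixes g :: "'a::metric_space \<Rightarrow> ennreal"
  assumes "continuous_on {0..l} \<gamma>" "g \<in> borel_measurable borel" "0 \<le> s" "s \<le> t" "t \<le> l"
  shows "curve_integral (\<lambda>x. \<gamma> (s + x)) (t - s) g = (\<integral>\<^sup>+x\<in>{s..t}. g (\<gamma> x) \<partial>lborel)"
proof -
  let ?f = "\<lambda>x. g (\<gamma> (max 0 (min l x))) * indicator {s..t} x"
  have m: "?f \<in> borel_measurable borel"
    using borel_measurable_along_curve[OF assms(1) _ assms(2)] assms by simp
  have "(\<integral>\<^sup>+x\<in>{s..t}. g (\<gamma> x) \<partial>lborel) = (\<integral>\<^sup>+x. ?f x \<partial>lborel)"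
    using assms by (intro nn_integral_cong) (auto simp: indicator_def)
  also have "\<dots> = (\<integral>\<^sup>+x. ?f (s + 1 * x) \<partial>lborel)"
    using nn_integral_real_affine[OF m, of 1 s] by simp
  also have "\<dots> = curve_integral (\<lambda>x. \<gamma> (s + x)) (t - s) g"
    unfolding curve_integral_def using assms
    by (intro nn_integral_cong) (auto simp: indicator_def)
  finally show ?thesis by simp
qed

text \<open>The inequality localises because every subinterval of positive length yields an arc
  length curve after translating the parameter.\<close>

lemma upper_gradient_subcurve:
  assumes "upper_gradient u g" "arc_length_curve \<gamma> l" "0 \<le> s" "s \<le> t" "t \<le> l"
  shows "ennreal \<bar>u (\<gamma> s) - u (\<gamma> t)\<bar> \<le> (\<integral>\<^sup>+x\<in>{s..t}. g (\<gamma> x) \<partial>lborel)"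
proof (cases "s = t")
  case False
  then have sub: "arc_length_curve (\<lambda>x. \<gamma> (s + x)) (t - s)" using assms by (intro arc_length_subcurve) auto
  have ug: "\<forall>\<gamma> l. arc_length_curve \<gamma> l \<longrightarrow> ennreal \<bar>u (\<gamma> 0) - u (\<gamma> l)\<bar> \<le> curve_integral \<gamma> l g"
    using assms(1) unfolding upper_gradient_def by (rule conjunct2)
  from ug[rule_format, OF sub] have "ennreal \<bar>u (\<gamma> (s + 0)) - u (\<gamma> (s + (t - s)))\<bar>
      \<le> curve_integral (\<lambda>x. \<gamma> (s + x)) (t - s) g" .
  then have "ennreal \<bar>u (\<gamma> s) - u (\<gamma> t)\<bar> \<le> curve_integral (\<lambda>x. \<gamma> (s + x)) (t - s) g"
    by simp
  also have "\<dots> = (\<integral>\<^sup>+x\<in>{s..t}. g (\<gamma> x) \<partial>lborel)"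
    by (rule curve_integral_subcurve[OF arc_length_curveD(2)[OF assms(2)] upper_gradient_borel[OF assms(1)] assms(3-5)])
  finally show ?thesis .
qed simp

text \<open>\<open>u\<close> itself need not be continuous. Along a curve with finite integral of
  \<open>g\<close>, its increments are dominated by those of the indefinite integral of
  \<open>g\<close> along the curve, which is continuous. This makes the intermediate value theorem
  available in the truncation argument.\<close>

lemma continuous_along_curve:
  assumes "upper_gradient u g" "arc_length_curve \<gamma> l" "curve_integral \<gamma> l g < \<infinity>"
  shows "continuous_on {0..l} (\<lambda>x. u (\<gamma> x))"
proof -
  note l = arc_length_curveD(1)[OF assms(2)] and cont = arc_length_curveD(2)[OF assms(2)]
    and g = upper_gradient_borel[OF assms(1)]
  define f where "f x = g (\<gamma> (max 0 (min l x))) * indicator {0..l} x" for x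
  have f [measurable]: "f \<in> borel_measurable borel"
  proof -
    note borel_measurable_along_curve[OF cont less_imp_le[OF l] g, measurable]
    show ?thesis unfolding f_def[abs_def] by measurable
  qed
  have "(\<integral>\<^sup>+x. f x \<partial>lborel) = curve_integral \<gamma> l g"
    unfolding f_def curve_integral_def by (intro nn_integral_cong) (auto simp: indicator_def)
  then have fin: "(\<integral>\<^sup>+x. f x \<partial>lborel) < \<infinity>" using assms(3) by simp
  then have "AE x in lborel. f x \<noteq> \<infinity>" by (intro nn_integral_noteq_infinite) auto
  then have AEf: "AE x in lborel. ennreal (enn2real (f x)) = f x"
    by eventually_elim (simp add: less_top)
  have "integrable lborel (\<lambda>x. enn2real (f x))"
  proof (rule integrableI_nonneg)
    have "(\<integral>\<^sup>+x. ennreal (enn2real (f x)) \<partial>lborel) = (\<integral>\<^sup>+x. f x \<partial>lborel)"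
      using AEf by (intro nn_integral_cong_AE) auto
    then show "(\<integral>\<^sup>+x. ennreal (enn2real (f x)) \<partial>lborel) < \<infinity>" using fin by simp
  qed auto
  note int = this
  define \<Phi> where "\<Phi> x = integral {0..x} (\<lambda>x. enn2real (f x))" for x
  have on: "(\<lambda>x. enn2real (f x)) integrable_on {s..t}" for s t
    using integrable_imp_set_integrable[OF int, of "{s..t}"] by (intro set_borel_integral_eq_integral) auto
  have inc: "\<bar>u (\<gamma> s) - u (\<gamma> t)\<bar> \<le> \<Phi> t - \<Phi> s" if "0 \<le> s" "s \<le> t" "t \<le> l" for s t
  proof -
    have "ennreal \<bar>u (\<gamma> s) - u (\<gamma> t)\<bar> \<le> (\<integral>\<^sup>+x\<in>{s..t}. g (\<gamma> x) \<partial>lborel)"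
      by (rule upper_gradient_subcurve[OF assms(1,2) that])
    also have "\<dots> = (\<integral>\<^sup>+x\<in>{s..t}. f x \<partial>lborel)"
      using that by (intro nn_integral_cong) (auto simp: f_def indicator_def)
    also have "\<dots> = (\<integral>\<^sup>+x\<in>{s..t}. ennreal (enn2real (f x)) \<partial>lborel)"
      using AEf by (intro nn_integral_cong_AE) (erule eventually_mono, simp)
    also have "\<dots> = ennreal (LINT x:{s..t}|lborel. enn2real (f x))"
      by (intro nn_integral_set_eq_integral int) auto
    also have "(LINT x:{s..t}|lborel. enn2real (f x)) = integral {s..t} (\<lambda>x. enn2real (f x))"
      using integrable_imp_set_integrable[OF int, of "{s..t}"] by (intro set_borel_integral_eq_integral) auto
    also have "\<dots> = \<Phi> t - \<Phi> s"
      using Henstock_Kurzweil_Integration.integral_combine[OF that(1,2) on] by (simp add: \<Phi>_def)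
    finally have *: "ennreal \<bar>u (\<gamma> s) - u (\<gamma> t)\<bar> \<le> ennreal (\<Phi> t - \<Phi> s)" .
    have "0 \<le> integral {s..t} (\<lambda>x. enn2real (f x))" by (intro integral_nonneg on) auto
    then have "0 \<le> \<Phi> t - \<Phi> s"
      using Henstock_Kurzweil_Integration.integral_combine[OF that(1,2) on] by (simp add: \<Phi>_def)
    then show ?thesis using * by simp
  qed
  have \<Phi>: "continuous_on {0..l} \<Phi>" unfolding \<Phi>_def by (intro indefinite_integral_continuous_1 on)
  show ?thesis
    unfolding continuous_on_iff
  proof (intro ballI allI impI)
    fix x e :: real assume x: "x \<in> {0..l}" and e: "0 < e"
    then obtain d where d: "0 < d" "\<And>y. y \<in> {0..l} \<Longrightarrow> dist y x < d \<Longrightarrow> dist (\<Phi> y) (\<Phi> x) < e"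
      using \<Phi> unfolding continuous_on_iff by blast
    show "\<exists>d>0. \<forall>x'\<in>{0..l}. dist x' x < d \<longrightarrow> dist (u (\<gamma> x')) (u (\<gamma> x)) < e"
    proof (intro exI[of _ d] conjI ballI impI d(1))
      fix y assume y: "y \<in> {0..l}" "dist y x < d"
      have "\<bar>u (\<gamma> y) - u (\<gamma> x)\<bar> \<le> \<bar>\<Phi> y - \<Phi> x\<bar>"
        using inc[of x y] inc[of y x] x y by (cases "x \<le> y") auto
      then show "dist (u (\<gamma> y)) (u (\<gamma> x)) < e" using d(2)[OF y] by (simp add: dist_real_def)
    qed
  qed
qed

text \<open>\<open>t\<close> is the first parameter with value \<open>f l\<close>, and
  \<open>s\<close> the last one before \<open>t\<close> with value \<open>f 0\<close>. If
  \<open>f\<close> left the open range between the two values inside the interval, the intermediate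
  value theorem would give a later hit of \<open>f 0\<close> or an earlier hit of
  \<open>f l\<close>.\<close>

lemma crossing_interval_less:
  fixes f :: "real \<Rightarrow> real"
  assumes cont: "continuous_on {0..l} f" and l: "0 \<le> l" and less: "f 0 < f l"
  obtains s t where "0 \<le> s" "s < t" "t \<le> l" "f s = f 0" "f t = f l"
    "\<forall>x. s < x \<and> x < t \<longrightarrow> f 0 < f x \<and> f x < f l"
proof -
  have cpt: "compact {x \<in> {a..b}. f x = y}" if "{a..b} \<subseteq> {0..l}" for a b y
    using continuous_closed_preimage_constant[OF continuous_on_subset[OF cont that], of y]
      compact_Int_closed[of "{a..b}" "{x \<in> {a..b}. f x = y}"]
    by (simp add: Int_def conj_ac Collect_conj_eq[symmetric])
  have "{x \<in> {0..l}. f x = f l} \<noteq> {}" using l by auto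
  then obtain t where t: "t \<in> {x \<in> {0..l}. f x = f l}" "\<And>x. x \<in> {x \<in> {0..l}. f x = f l} \<Longrightarrow> t \<le> x"
    using compact_attains_inf[OF cpt[of 0 l "f l"]] by blast
  have "{x \<in> {0..t}. f x = f 0} \<noteq> {}" using t by auto
  then obtain s where s: "s \<in> {x \<in> {0..t}. f x = f 0}" "\<And>x. x \<in> {x \<in> {0..t}. f x = f 0} \<Longrightarrow> x \<le> s"
    using compact_attains_sup[OF cpt[of 0 t "f 0"]] t by auto
  show thesis
  proof
    show "0 \<le> s" "t \<le> l" "f s = f 0" "f t = f l" using s t by auto
    show "s < t" using s(1) t(1) less by (cases "s = t") auto
    have "f 0 < f x \<and> f x < f l" if x: "s < x" "x < t" for x
    proof (intro conjI; rule ccontr)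
      assume "\<not> f 0 < f x"
      then obtain z where "x \<le> z" "z \<le> t" "f z = f 0"
        using IVT'[of f x "f 0" t] x s(1) t(1) less continuous_on_subset[OF cont, of "{x..t}"] by auto
      then show False using s(1) s(2)[of z] x by simp
    next
      assume "\<not> f x < f l"
      then obtain z where "s \<le> z" "z \<le> x" "f z = f l"
        using IVT'[of f s "f l" x] x s(1) t(1) less continuous_on_subset[OF cont, of "{s..x}"] by auto
      then show False using s(1) t(1) t(2)[of z] x by simp
    qed
    then show "\<forall>x. s < x \<and> x < t \<longrightarrow> f 0 < f x \<and> f x < f l" by blast
  qed
qed

lemma crossing_interval:
  fixes f :: "real \<Rightarrow> real"
  assumes cont: "continuous_on {0..l} f" and l: "0 \<le> l" and neq: "f 0 \<noteq> f l"
  obtains s t where "0 \<le> s" "s < t" "t \<le> l" "f s = f 0" "f t = f l"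
    "\<forall>x. s < x \<and> x < t \<longrightarrow> min (f 0) (f l) < f x \<and> f x < max (f 0) (f l)"
proof (cases "f 0 < f l")
  case True
  then obtain s t where "0 \<le> s" "s < t" "t \<le> l" "f s = f 0" "f t = f l"
    "\<forall>x. s < x \<and> x < t \<longrightarrow> f 0 < f x \<and> f x < f l"
    by (rule crossing_interval_less[OF cont l])
  then show thesis using True by (intro that[of s t]) auto
next
  case False
  then have "- f 0 < - f l" using neq by simp
  then obtain s t where "0 \<le> s" "s < t" "t \<le> l" "- f s = - f 0" "- f t = - f l"
    "\<forall>x. s < x \<and> x < t \<longrightarrow> - f 0 < - f x \<and> - f x < - f l"
    by (rule crossing_interval_less[OF continuous_on_minus[OF cont] l])
  then show thesis using False neq by (intro that[of s t]) auto
qed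

text \<open>
  Between the last parameter before the crossing and the first one after it, the curve stays in
  the level set where the truncation is not locally constant; only this part of it is used.
\<close>

lemma weak_upper_gradient_truncation:
  fixes u :: "'a::metric_space \<Rightarrow> real"
  assumes ug: "upper_gradient u g" and fin: "(\<integral>\<^sup>+x. epowr (g x) p \<partial>M) < \<infinity>"
    and A: "A \<in> sets borel" "{x. t < \<bar>u x - a\<bar> \<and> \<bar>u x - a\<bar> < 2 * t} \<subseteq> A" and t: "0 < t"
  shows "weak_upper_gradient M p (\<lambda>x. min (max (\<bar>u x - a\<bar> - t) 0) t) (\<lambda>x. g x * indicator A x)"
  unfolding weak_upper_gradient_def almost_every_curve_def
\<comment> \<open>\<open>g\<close> is its own witness for the exceptional family: the inequality is
  shown for every curve along which \<open>g\<close> has finite integral.\<close>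
proof (intro conjI bexI[of _ g] fin allI impI)
  have g: "g \<in> borel_measurable borel" by (rule upper_gradient_borel[OF ug])
  then show "g \<in> borel_measurable borel" .
  show "(\<lambda>x. g x * indicator A x) \<in> borel_measurable borel" using g A by simp
  define w where "w x = min (max (\<bar>u x - a\<bar> - t) 0) t" for x
  fix \<gamma> l
  assume \<gamma>: "arc_length_curve \<gamma> l" and not: "\<not> ennreal \<bar>min (max (\<bar>u (\<gamma> 0) - a\<bar> - t) 0) t - min (max (\<bar>u (\<gamma> l) - a\<bar> - t) 0) t\<bar>
    \<le> curve_integral \<gamma> l (\<lambda>x. g x * indicator A x)"
  have l: "0 < l" by (rule arc_length_curveD[OF \<gamma>])
  show "curve_integral \<gamma> l g = \<infinity>"
  proof (rule ccontr)
    assume "curve_integral \<gamma> l g \<noteq> \<infinity>"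
    then have "continuous_on {0..l} (\<lambda>x. u (\<gamma> x))"
      using continuous_along_curve[OF ug \<gamma>] by (simp add: less_top)
    then have cont: "continuous_on {0..l} (\<lambda>x. w (\<gamma> x))"
      unfolding w_def by (intro continuous_intros)
    have "w (\<gamma> 0) \<noteq> w (\<gamma> l)" using not by (auto simp: w_def)
    then obtain r s where rs: "0 \<le> r" "r < s" "s \<le> l" "w (\<gamma> r) = w (\<gamma> 0)" "w (\<gamma> s) = w (\<gamma> l)"
      and bet: "\<forall>x. r < x \<and> x < s \<longrightarrow> min (w (\<gamma> 0)) (w (\<gamma> l)) < w (\<gamma> x) \<and> w (\<gamma> x) < max (w (\<gamma> 0)) (w (\<gamma> l))"
      by (rule crossing_interval[OF cont less_imp_le[OF l]])
    have inA: "\<gamma> x \<in> A" if "r < x" "x < s" for x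
    proof -
      have "0 \<le> min (w (\<gamma> 0)) (w (\<gamma> l))" "max (w (\<gamma> 0)) (w (\<gamma> l)) \<le> t"
        using t by (auto simp: w_def)
      then have "0 < w (\<gamma> x)" "w (\<gamma> x) < t" using bet that by fastforce+
      then have "t < \<bar>u (\<gamma> x) - a\<bar> \<and> \<bar>u (\<gamma> x) - a\<bar> < 2 * t" unfolding w_def by linarith
      then show ?thesis using A by blast
    qed
    have "\<bar>w (\<gamma> 0) - w (\<gamma> l)\<bar> = \<bar>w (\<gamma> r) - w (\<gamma> s)\<bar>" using rs by simp
    also have "\<dots> \<le> \<bar>u (\<gamma> r) - u (\<gamma> s)\<bar>" unfolding w_def by linarith
    finally have "ennreal \<bar>w (\<gamma> 0) - w (\<gamma> l)\<bar> \<le> ennreal \<bar>u (\<gamma> r) - u (\<gamma> s)\<bar>" by (rule ennreal_leI)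
    also have "\<dots> \<le> (\<integral>\<^sup>+x\<in>{r..s}. g (\<gamma> x) \<partial>lborel)"
      using rs by (intro upper_gradient_subcurve[OF ug \<gamma>]) auto
    also have "\<dots> \<le> curve_integral \<gamma> l (\<lambda>x. g x * indicator A x)"
      unfolding curve_integral_def
    \<comment> \<open>The end points \<open>r\<close> and \<open>s\<close> may lie outside
      \<open>A\<close>, hence a comparison almost everywhere.\<close>
    proof (rule nn_integral_mono_AE)
      have "AE x in lborel. x \<noteq> r" "AE x in lborel. x \<noteq> s" by (rule AE_lborel_singleton)+
      then show "AE x in lborel. g (\<gamma> x) * indicator {r..s} x \<le> g (\<gamma> x) * indicator A (\<gamma> x) * indicator {0..l} x"
      proof eventually_elim
        case (elim x)
        show ?case
        proof (cases "x \<in> {r..s}")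
          case True
          then have "\<gamma> x \<in> A" "x \<in> {0..l}" using elim rs inA[of x] by auto
          then show ?thesis using True by simp
        qed simp
      qed
    qed
    finally show False using not by (simp add: w_def)
  qed
qed

section \<open>Spaces of finite measure with volume decay\<close>

locale volume_decay_space = finite_measure M
  for M :: "'a::metric_space measure" +
  fixes c Q :: real
  assumes space_UNIV: "space M = UNIV"
    and borel_sets: "sets borel \<subseteq> sets M"
    and ball_pos: "0 < r \<Longrightarrow> 0 < measure M (ball x r)"
    and c_pos: "0 < c" and Q_pos: "0 < Q"
    and decay: "\<lbrakk>dist x y < R; 0 < r; r \<le> R\<rbrakk> \<Longrightarrow>
      c * (r / R) powr Q * measure M (ball x R) \<le> measure M (ball y r)"
begin

abbreviation vol :: "'a \<Rightarrow> real \<Rightarrow> real" where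
  "vol x r \<equiv> measure M (ball x r)"

lemma ball_sets [measurable, simp]: "ball x r \<in> sets M"
  using borel_sets by auto

lemma vol_mono: "ball x r \<subseteq> ball y s \<Longrightarrow> vol x r \<le> vol y s"
  by (rule finite_measure_mono) auto

lemma vol_mono_radius: "r \<le> s \<Longrightarrow> vol x r \<le> vol x s"
  by (rule vol_mono) auto

text \<open>Decay with a bounded ratio of radii: the form in which doubling is used from here on,
  with the centre allowed to move.\<close>

lemma vol_le_shrunk:
  assumes "dist x y < R" "0 < r" "r \<le> R" "R \<le> k * r"
  shows "vol x R \<le> k powr Q / c * vol y r"
proof -
  have "k > 0"
    using assms by (smt (verit) mult_nonneg_nonneg mult_nonpos_nonneg)
  have "1 / k \<le> r / R"
    using assms \<open>k > 0\<close> by (simp add: field_simps)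
  then have "(1 / k) powr Q \<le> (r / R) powr Q"
    using \<open>k > 0\<close> Q_pos by (intro powr_mono2) auto
  then have "c * (1 / k) powr Q * vol x R \<le> c * (r / R) powr Q * vol x R"
    using c_pos by (intro mult_right_mono mult_left_mono) auto
  also have "\<dots> \<le> vol y r" using decay assms by auto
  finally have "c * (1 / k) powr Q * vol x R \<le> vol y r" .
  moreover have "(1 / k) powr Q = 1 / k powr Q"
    using \<open>k > 0\<close> by (simp add: powr_divide)
  ultimately show ?thesis using c_pos \<open>k > 0\<close>
    by (simp add: field_simps)
qed

text \<open>Take a ball around \<open>z\<close> carrying all but a small fraction of the total mass.
  A point \<open>x\<close> at large distance \<open>d\<close> would have a ball of radius
  \<open>d / 2\<close> disjoint from it, yet by decay this ball carries at least the fraction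
  \<kappa> of \<open>vol z (2 * d)\<close>, and the two together exceed the total mass. The 4 in
  \<kappa> is the ratio of \<open>2 * d\<close> to \<open>d / 2\<close>.\<close>

lemma bounded_space: "\<exists>R. \<forall>x. dist (z::'a) x < R"
proof -
  define \<kappa> where "\<kappa> = c / 4 powr Q"
  have \<kappa>: "\<kappa> > 0" using c_pos by (auto simp: \<kappa>_def)
  have mpos: "measure M (space M) > 0"
    using ball_pos[of 1 z] bounded_measure[of "ball z 1"] by linarith
  have "(\<Union>n::nat. ball z (real n)) = UNIV"
    using reals_Archimedean2 by auto
  then have "(\<lambda>n. measure M (ball z (real n))) \<longlonglongrightarrow> measure M (space M)"
    using finite_Lim_measure_incseq[of "\<lambda>n. ball z (real n)"]
    by (simp add: incseq_def space_UNIV image_subset_iff subset_ball)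
  moreover have "measure M (space M) / (1 + \<kappa>) < measure M (space M)"
    using \<kappa> mpos by (simp add: field_simps)
  ultimately have "eventually (\<lambda>n. measure M (space M) / (1 + \<kappa>) < vol z (real n)) sequentially"
    by (rule order_tendstoD)
  then have "eventually (\<lambda>n. n \<ge> 1 \<and> measure M (space M) / (1 + \<kappa>) < vol z (real n)) sequentially"
    using eventually_ge_at_top eventually_conj by blast
  then obtain n :: nat where n: "n \<ge> 1" "measure M (space M) / (1 + \<kappa>) < vol z (real n)"
    by (auto simp: eventually_sequentially)
  have "dist z x < 2 * n" for x
  proof (rule ccontr)
    define d where "d = dist z x"
    assume "\<not> ?thesis"
    then have d: "d \<ge> 2 * n" "d > 0" using n by (auto simp: d_def)
    have disj: "ball z (real n) \<inter> ball x (d / 2) = {}"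
    proof (rule ccontr)
      assume "\<not> ?thesis"
      then obtain w where "dist z w < n" "dist x w < d / 2" by auto
      then show False using dist_triangle2[of z x w] d by (auto simp: d_def)
    qed
    have "vol z (2 * d) \<le> 4 powr Q / c * vol x (d / 2)"
      using d by (intro vol_le_shrunk) (auto simp: d_def)
    then have "\<kappa> * vol z (2 * d) \<le> vol x (d / 2)"
      using c_pos by (simp add: \<kappa>_def field_simps)
    moreover have "vol z n \<le> vol z (2 * d)" using d by (intro vol_mono_radius) auto
    ultimately have "\<kappa> * vol z n \<le> vol x (d / 2)"
      using \<kappa> by (smt (verit) mult_left_mono)
    moreover have "vol z n + vol x (d / 2) = measure M (ball z (real n) \<union> ball x (d / 2))"
      using disj by (simp add: finite_measure_Union)
    moreover have "\<dots> \<le> measure M (space M)" by (rule bounded_measure)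
    ultimately have "(1 + \<kappa>) * vol z n \<le> measure M (space M)" by (simp add: algebra_simps)
    then show False using n \<kappa> by (simp add: field_simps)
  qed
  then show ?thesis by blast
qed

text \<open>\<open>4 * k\<close> is the ratio of the radii \<open>2 * k * \<rho>\<close> and
  \<open>\<rho> / 2\<close> in the packing argument that follows.\<close>

definition overlap :: "real \<Rightarrow> real" where
  "overlap k = (4 * k) powr Q / c"

text \<open>Packing: the balls of radius \<open>\<rho> / 2\<close> around the points of
  \<open>S\<close> are disjoint, lie in \<open>ball x (2 * k * \<rho>)\<close>, and each carries at
  least the fraction \<open>1 / overlap k\<close> of its mass.\<close>

lemma card_separated_le:
  assumes "0 < \<rho>" "1 \<le> k" "finite S" "S \<subseteq> ball (x::'a) (k * \<rho>)"
    and sep: "\<And>y z. \<lbrakk>y \<in> S; z \<in> S; y \<noteq> z\<rbrakk> \<Longrightarrow> \<rho> \<le> dist y z"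
  shows "real (card S) \<le> overlap k"
proof -
  have kr: "\<rho> \<le> k * \<rho>" "k * \<rho> > 0" using assms by auto
  have disj: "disjoint_family_on (\<lambda>z. ball z (\<rho> / 2)) S"
    unfolding disjoint_family_on_def
  proof (intro ballI impI, rule ccontr)
    fix y z assume *: "y \<in> S" "z \<in> S" "y \<noteq> z" "ball y (\<rho> / 2) \<inter> ball z (\<rho> / 2) \<noteq> {}"
    then obtain w where "dist y w < \<rho> / 2" "dist z w < \<rho> / 2" by auto
    then show False using dist_triangle2[of y z w] sep[of y z] * by auto
  qed
  have big: "vol x (2 * k * \<rho>) \<le> overlap k * vol z (\<rho> / 2)" if "z \<in> S" for z
    unfolding overlap_def
  proof (intro vol_le_shrunk)
    have "dist x z < k * \<rho>" using assms(4) that by auto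
    then show "dist x z < 2 * k * \<rho>" using kr by linarith
  qed (use kr \<open>0 < \<rho>\<close> in auto)
  have "ball z (\<rho> / 2) \<subseteq> ball x (2 * k * \<rho>)" if "z \<in> S" for z
  proof
    fix w assume "w \<in> ball z (\<rho> / 2)"
    then have "dist z w < \<rho> / 2" by simp
    moreover have "dist x z < k * \<rho>" using assms(4) that by auto
    ultimately show "w \<in> ball x (2 * k * \<rho>)"
      using dist_triangle[of x w z] kr by auto
  qed
  then have sub: "(\<Union>z\<in>S. ball z (\<rho> / 2)) \<subseteq> ball x (2 * k * \<rho>)" by blast
  have "real (card S) * vol x (2 * k * \<rho>) = (\<Sum>z\<in>S. vol x (2 * k * \<rho>))" by simp
  also have "\<dots> \<le> (\<Sum>z\<in>S. overlap k * vol z (\<rho> / 2))" by (rule sum_mono) (rule big)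
  also have "\<dots> = overlap k * measure M (\<Union>z\<in>S. ball z (\<rho> / 2))"
    using disj \<open>finite S\<close> by (subst finite_measure_finite_Union) (auto simp: sum_distrib_left)
  also have "\<dots> \<le> overlap k * vol x (2 * k * \<rho>)"
    using sub c_pos by (intro mult_left_mono finite_measure_mono) (auto simp: overlap_def)
  finally have "real (card S) * vol x (2 * k * \<rho>) \<le> overlap k * vol x (2 * k * \<rho>)" .
  moreover have "0 < vol x (2 * k * \<rho>)" using kr by (intro ball_pos) linarith
  ultimately show ?thesis by (rule mult_right_le_imp_le)
qed

text \<open>Since the space is bounded, packing bounds the size of every separated set, so one of
  maximal cardinality exists. Maximality gives the covering property, and packing once more gives
  the multiplicity bound.\<close>

lemma finite_net:
  assumes "0 < \<rho>"
  obtains S :: "'a set" where "finite S" "\<And>x. \<exists>z\<in>S. dist z x < \<rho>"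
    "\<And>x k. 1 \<le> k \<Longrightarrow> real (card {z \<in> S. dist z x < k * \<rho>}) \<le> overlap k"
proof -
  define sep where "sep S \<longleftrightarrow> finite S \<and> (\<forall>y\<in>S. \<forall>z\<in>S. y \<noteq> z \<longrightarrow> \<rho> \<le> dist y z)" for S :: "'a set"
  fix z0 :: 'a
  obtain R where R: "\<And>x. dist z0 x < R" using bounded_space by blast
  define k where "k = max 1 (R / \<rho>)"
  have k: "k \<ge> 1" "R \<le> k * \<rho>" using assms by (auto simp: k_def field_simps max_def)
  have cb: "card S < Suc (nat \<lceil>overlap k\<rceil>)" if "sep S" for S
  proof -
    have "S \<subseteq> ball z0 (k * \<rho>)" using R k by (fastforce intro: less_le_trans)
    then have "real (card S) \<le> overlap k"
      using that k assms by (intro card_separated_le) (auto simp: sep_def)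
    then show ?thesis by linarith
  qed
  have "sep {}" by (auto simp: sep_def)
  then obtain S where S: "sep S" "\<And>T. sep T \<Longrightarrow> card T \<le> card S"
    using ex_has_greatest_nat[of sep "{}" card] cb by blast
  show thesis
  proof
    show "finite S" using S by (auto simp: sep_def)
    show "\<exists>z\<in>S. dist z x < \<rho>" for x
    proof (rule ccontr)
      assume *: "\<not> ?thesis"
      then have "sep (insert x S)" "x \<notin> S"
        using S(1) assms by (auto simp: sep_def dist_commute not_less) 
      then show False using S(2)[of "insert x S"] \<open>finite S\<close> by auto
    qed
    show "real (card {z \<in> S. dist z x < k * \<rho>}) \<le> overlap k" if "1 \<le> k" for x k
      using S(1) that assms
      by (intro card_separated_le[of \<rho> _ _ x]) (auto simp: sep_def dist_commute)
  qed
qed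

end

section \<open>The weak type estimate\<close>

text \<open>Gradients disappear here: only the measure \<open>N\<close> with density
  \<open>g\<^sup>p\<close> survives, and \<open>measure_le_N\<close> is what remains of
  \<open>g \<ge> 1\<close>.\<close>

locale poincare_setting = volume_decay_space M c Q + N: finite_measure N
  for M N :: "'a::metric_space measure" and c Q +
  fixes p \<sigma> C :: real
  assumes sets_N: "sets N = sets M"
    and measure_le_N: "A \<in> sets M \<Longrightarrow> measure M A \<le> measure N A"
    and p_gt_1: "1 < p" and p_less_Q: "p < Q" and \<sigma>_ge_1: "1 \<le> \<sigma>" and C_pos: "0 < C"
begin

definition dens :: "'a set \<Rightarrow> 'a \<Rightarrow> real \<Rightarrow> real" where
  "dens A x s = measure N (A \<inter> ball x s) / vol x s"

text \<open>This is the Poincare inequality for \<open>w\<close> with gradient \<open>g\<close> cut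
  off outside \<open>A\<close>: \<open>dens A\<close> is the mean of the p-th power of that
  gradient. The volume is multiplied out and the diameter is replaced by the radius.\<close>

definition poincare_pair :: "('a \<Rightarrow> real) \<Rightarrow> 'a set \<Rightarrow> bool" where
  "poincare_pair w A \<longleftrightarrow> integrable M w \<and> A \<in> sets M \<and>
     (\<forall>x r. 0 < r \<longrightarrow> (LINT y:ball x r|M. \<bar>w y - average M (ball x r) w\<bar>)
        \<le> C * r * vol x r * dens A x (\<sigma> * r) powr (1 / p))"

text \<open>The absolute value stands inside the mean because this form passes to truncations of
  \<open>w\<close>; mere convergence of the averages does not.\<close>

definition lebesgue_point :: "('a \<Rightarrow> real) \<Rightarrow> 'a \<Rightarrow> bool" where
  "lebesgue_point w x \<longleftrightarrow>
     ((\<lambda>r. average M (ball x r) (\<lambda>y. \<bar>w y - w x\<bar>)) \<longlongrightarrow> 0) (at_right 0)"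

lemma dens_nonneg: "0 \<le> dens A x s"
  by (simp add: dens_def)

definition C1 :: real where "C1 = 2 powr Q / c * C"

lemma C1_pos: "0 < C1"
  using c_pos C_pos by (simp add: C1_def)

lemma abs_average_diff_le:
  assumes "integrable M w" "E \<in> sets M" "measure M E > 0"
  shows "\<bar>average M E w - a\<bar> \<le> average M E (\<lambda>y. \<bar>w y - a\<bar>)"
proof -
  have i: "set_integrable M E w" "set_integrable M E (\<lambda>_. a)"
    using assms by (auto intro: integrable_imp_set_integrable)
  have "(LINT y:E|M. w y - a) = (LINT y:E|M. w y) - measure M E * a"
    using i assms by (simp add: set_integral_diff set_integral_const)
  then have "average M E w - a = (LINT y:E|M. w y - a) / measure M E"
    using assms by (simp add: average_def field_simps)
  also have "\<bar>\<dots>\<bar> \<le> (LINT y:E|M. \<bar>w y - a\<bar>) / measure M E"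
    using set_integral_norm_bound[OF set_integral_diff(1)[OF i]] assms
    by (simp add: divide_right_mono)
  finally show ?thesis by (simp add: average_def)
qed

lemma lebesgue_point_tendsto:
  assumes "integrable M w" "lebesgue_point w x"
  shows "((\<lambda>r. average M (ball x r) w) \<longlongrightarrow> w x) (at_right 0)"
proof -
  have "((\<lambda>r. average M (ball x r) w - w x) \<longlongrightarrow> 0) (at_right 0)"
  proof (rule Lim_null_comparison)
    show "((\<lambda>r. average M (ball x r) (\<lambda>y. \<bar>w y - w x\<bar>)) \<longlongrightarrow> 0) (at_right 0)"
      using assms by (simp add: lebesgue_point_def)
    show "eventually (\<lambda>r. norm (average M (ball x r) w - w x)
        \<le> average M (ball x r) (\<lambda>y. \<bar>w y - w x\<bar>)) (at_right 0)"
      unfolding eventually_at_right_field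
      using assms(1) by (intro exI[of _ 1]) (auto intro!: abs_average_diff_le ball_pos)
  qed
  then show ?thesis by (simp add: LIM_zero_iff)
qed

text \<open>Both averages are compared through the mean deviation from the average over the larger
  ball. Shrinking the domain to the half ball costs one doubling factor, which is the factor in
  \<open>C1\<close>.\<close>

lemma average_halving_le:
  assumes "poincare_pair w A" "0 < s"
  shows "\<bar>average M (ball x (s / 2)) w - average M (ball x s) w\<bar>
    \<le> C1 * s * dens A x (\<sigma> * s) powr (1 / p)"
proof -
  let ?a = "average M (ball x s) w"
  have w: "integrable M w" using assms by (simp add: poincare_pair_def)
  have "\<bar>average M (ball x (s / 2)) w - ?a\<bar> \<le> average M (ball x (s / 2)) (\<lambda>y. \<bar>w y - ?a\<bar>)"
    using assms w by (intro abs_average_diff_le ball_pos) auto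
  also have "\<dots> \<le> (LINT y:ball x s|M. \<bar>w y - ?a\<bar>) / vol x (s / 2)"
    unfolding average_def using w assms
    by (intro divide_right_mono set_integral_mono_set) auto
  also have "\<dots> \<le> C * s * vol x s * dens A x (\<sigma> * s) powr (1 / p) / vol x (s / 2)"
    using assms by (intro divide_right_mono) (auto simp: poincare_pair_def)
  also have "\<dots> = (vol x s / vol x (s / 2)) * (C * s * dens A x (\<sigma> * s) powr (1 / p))" by simp
  also have "\<dots> \<le> (2 powr Q / c) * (C * s * dens A x (\<sigma> * s) powr (1 / p))"
    using vol_le_shrunk[of x x s "s / 2" 2] assms ball_pos[of "s / 2" x] C_pos
    by (intro mult_right_mono) (auto simp: field_simps)
  finally show ?thesis by (simp add: C1_def mult_ac)
qed

text \<open>At a single scale a net suffices. If the density at \<open>x\<close> exceeds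
  \<open>l\<close>, a net point \<open>z\<close> within \<open>s\<close> of \<open>x\<close> has
  almost the same property, with \<open>ball z (2 * s)\<close> and one doubling factor; the selected
  balls are then summed by bounded overlap. A doubled ball that matters reaches at most
  \<open>s + 2 * s\<close> beyond \<open>ball x0 r\<close>, which explains
  \<open>r + 3 * s \<le> R\<close>. The conclusion offers a measurable cover \<open>E\<close>, so
  measurability of the superlevel set is never at issue.\<close>

lemma density_superlevel_cover:
  assumes "A \<in> sets M" "0 < s" "0 < l" "r + 3 * s \<le> R"
  obtains E where "E \<in> sets M" "\<And>x. \<lbrakk>x \<in> ball x0 r; l < dens A x s\<rbrakk> \<Longrightarrow> x \<in> E"
    "measure M E \<le> 2 powr Q / c * overlap 2 * measure N (A \<inter> ball x0 R) / l"
proof -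
  let ?K = "2 powr Q / c"
  obtain S :: "'a set" where S: "finite S" "\<And>x. \<exists>z\<in>S. dist z x < s"
    "\<And>x k. 1 \<le> k \<Longrightarrow> real (card {z \<in> S. dist z x < k * s}) \<le> overlap k"
    using finite_net[OF \<open>0 < s\<close>] by blast
  define S' where "S' = {z \<in> S. ball z s \<inter> ball x0 r \<noteq> {} \<and>
    l * vol z s \<le> ?K * measure N (A \<inter> ball z (2 * s))}"
  define E where "E = (\<Union>z\<in>S'. ball z s)"
  have finS': "finite S'" using S by (simp add: S'_def)
  show thesis
  proof
    show "E \<in> sets M" using finS' by (auto simp: E_def)
    show "x \<in> E" if x: "x \<in> ball x0 r" "l < dens A x s" for x
    proof -
      obtain z where z: "z \<in> S" "dist z x < s" using S by blast
      have "vol z s \<le> vol x (2 * s)"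
      proof (intro vol_mono subsetI)
        fix w assume "w \<in> ball z s"
        then show "w \<in> ball x (2 * s)" using z dist_triangle[of x w z] by (simp add: dist_commute)
      qed
      also have "\<dots> \<le> ?K * vol x s" using assms by (intro vol_le_shrunk) auto
      finally have "l * vol z s \<le> l * (?K * vol x s)"
        using assms by (intro mult_left_mono) auto
      also have "\<dots> = ?K * (l * vol x s)" by simp
      also have "l * vol x s \<le> measure N (A \<inter> ball x s)"
        using x ball_pos[of s x] assms by (simp add: dens_def field_simps)
      also have "\<dots> \<le> measure N (A \<inter> ball z (2 * s))"
      proof (rule N.finite_measure_mono)
        show "A \<inter> ball x s \<subseteq> A \<inter> ball z (2 * s)"
        proof (rule Int_mono[OF order_refl], rule subsetI)
          fix w assume "w \<in> ball x s"
          then show "w \<in> ball z (2 * s)" using z dist_triangle[of z w x] by simp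
        qed
      qed (use assms sets_N in auto)
      finally have "l * vol z s \<le> ?K * measure N (A \<inter> ball z (2 * s))"
        using c_pos by (simp add: mult_left_mono divide_right_mono)
      then have "z \<in> S'" using z x by (auto simp: S'_def)
      then show ?thesis using z by (auto simp: E_def)
    qed
    have "l * measure M E \<le> l * (\<Sum>z\<in>S'. vol z s)"
      unfolding E_def using finS' assms
      by (intro mult_left_mono finite_measure_subadditive_finite) auto
    also have "\<dots> \<le> (\<Sum>z\<in>S'. ?K * measure N (A \<inter> ball z (2 * s)))"
      unfolding sum_distrib_left by (rule sum_mono) (auto simp: S'_def)
    also have "\<dots> = ?K * (\<Sum>z\<in>S'. measure N (A \<inter> ball z (2 * s)))"
      by (simp add: sum_distrib_left)
    also have "\<dots> \<le> ?K * (overlap 2 * measure N (A \<inter> ball x0 R))"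
    proof (intro mult_left_mono sum_measure_overlap_le)
      show "A \<inter> ball z (2 * s) \<subseteq> A \<inter> ball x0 R" if "z \<in> S'" for z
      proof (rule Int_mono[OF order_refl], rule subsetI)
        fix w assume "w \<in> ball z (2 * s)"
        moreover obtain y where "dist z y < s" "dist x0 y < r" using \<open>z \<in> S'\<close> by (auto simp: S'_def)
        ultimately show "w \<in> ball x0 R" using assms(4) dist_triangle[of x0 w z] dist_triangle2[of x0 z y] by simp
      qed
      show "real (card {z \<in> S'. x \<in> A \<inter> ball z (2 * s)}) \<le> overlap 2" for x
      proof -
        have "card {z \<in> S'. x \<in> A \<inter> ball z (2 * s)} \<le> card {z \<in> S. dist z x < 2 * s}"
          using S by (intro card_mono) (auto simp: S'_def)
        also have "real \<dots> \<le> overlap 2" using S(3)[of 2 x] by simp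
        finally show ?thesis by simp
      qed
    qed (use assms sets_N finS' c_pos N.finite_measure_axioms in auto)
    finally show "measure M E \<le> ?K * overlap 2 * measure N (A \<inter> ball x0 R) / l"
      using assms c_pos by (simp add: pos_le_divide_eq mult_ac)
  qed
qed

section \<open>Telescoping averages over dyadic scales\<close>

lemma average_telescope:
  assumes "poincare_pair w A" "0 < s"
  shows "\<bar>average M (ball x (s / 2 ^ n)) w - average M (ball x s) w\<bar>
    \<le> (\<Sum>i<n. C1 * (s / 2 ^ i) * dens A x (\<sigma> * (s / 2 ^ i)) powr (1 / p))"
proof (induction n)
  case (Suc n)
  have "\<bar>average M (ball x (s / 2 ^ n / 2)) w - average M (ball x (s / 2 ^ n)) w\<bar>
      \<le> C1 * (s / 2 ^ n) * dens A x (\<sigma> * (s / 2 ^ n)) powr (1 / p)"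
    using assms by (intro average_halving_le) auto
  also have "s / 2 ^ n / 2 = s / 2 ^ Suc n" by simp
  finally show ?case using Suc unfolding sum.lessThan_Suc by linarith
qed simp

text \<open>Up to constants, the p-th power of the right-hand side of the Poincare inequality, so
  its power \<open>1 / p\<close> scales like \<open>w\<close>. The dilation
  \<open>4 * \<sigma>\<close> leaves room for moved centres:
  \<open>r + 3 * (\<sigma> * r) \<le> 4 * \<sigma> * r\<close>.\<close>

definition normalized_energy :: "'a set \<Rightarrow> 'a \<Rightarrow> real \<Rightarrow> real" where
  "normalized_energy A x r = r powr p * (measure N (A \<inter> ball x (4 * \<sigma> * r)) / vol x r)"

lemma normalized_energy_nonneg: "0 \<le> normalized_energy A x r"
  by (simp add: normalized_energy_def)

text \<open>Decay bounds the density at scale \<open>r / 2 ^ i\<close> by a constant times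
  \<open>2 powr (i * Q)\<close> times the one at scale \<open>r\<close>. After the root and the
  factor \<open>2 ^ (- i)\<close> from the radius, the i-th step is of order \<open>b ^ i\<close>.
  Since \<open>p < Q\<close> gives \<open>b > 1\<close>, the last step dominates the sum.\<close>

lemma average_large_scales:
  assumes "poincare_pair w A" "0 < r" "x \<in> ball x0 r"
  defines "b \<equiv> 2 powr (Q / p - 1)"
  shows "\<bar>average M (ball x (r / 2 ^ J)) w - average M (ball x r) w\<bar>
    \<le> C1 / c powr (1 / p) / (b - 1) * b ^ J * normalized_energy A x0 r powr (1 / p)"
proof -
  let ?Y = "measure N (A \<inter> ball x0 (4 * \<sigma> * r))"
  let ?\<gamma> = "normalized_energy A x0 r"
  have b: "b > 1" unfolding b_def using p_gt_1 p_less_Q by simp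
  have A: "A \<in> sets M" using assms by (simp add: poincare_pair_def)
  have "1 * r \<le> \<sigma> * r" using \<sigma>_ge_1 assms by (intro mult_right_mono) auto
  then have sr: "r \<le> \<sigma> * r" by simp
  have m: "vol x0 r > 0" using assms by (simp add: ball_pos)
  have step: "C1 * (r / 2 ^ i) * dens A x (\<sigma> * (r / 2 ^ i)) powr (1 / p)
      \<le> C1 / c powr (1 / p) * ?\<gamma> powr (1 / p) * b ^ i" for i
  proof -
    have si: "0 < \<sigma> * (r / 2 ^ i)" "\<sigma> * (r / 2 ^ i) \<le> \<sigma> * r"
      using \<sigma>_ge_1 assms by (auto simp: field_simps)
    have "vol x0 r \<le> vol x0 (\<sigma> * r)" using sr by (rule vol_mono_radius)
    also have "\<dots> \<le> (2 ^ i) powr Q / c * vol x (\<sigma> * (r / 2 ^ i))"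
    proof (intro vol_le_shrunk)
      show "dist x0 x < \<sigma> * r" using assms(3) sr by simp
    qed (use si in auto)
    finally have v: "vol x0 r \<le> (2 ^ i) powr Q / c * vol x (\<sigma> * (r / 2 ^ i))" .
    have "measure N (A \<inter> ball x (\<sigma> * (r / 2 ^ i))) \<le> ?Y"
    proof (rule N.finite_measure_mono)
      show "A \<inter> ball x (\<sigma> * (r / 2 ^ i)) \<subseteq> A \<inter> ball x0 (4 * \<sigma> * r)"
      proof (rule Int_mono[OF order_refl], rule subsetI)
        fix y assume "y \<in> ball x (\<sigma> * (r / 2 ^ i))"
        then have "dist x y < \<sigma> * (r / 2 ^ i)" "dist x0 x < r" using assms(3) by auto
        then have "dist x0 y < r + \<sigma> * r" using dist_triangle[of x0 y x] si by linarith
        moreover have "r + \<sigma> * r \<le> 4 * \<sigma> * r" using sr assms(2) by linarith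
        ultimately show "y \<in> ball x0 (4 * \<sigma> * r)" by simp
      qed
    qed (use A sets_N in auto)
    then have "dens A x (\<sigma> * (r / 2 ^ i)) \<le> ?Y / vol x (\<sigma> * (r / 2 ^ i))"
      unfolding dens_def by (intro divide_right_mono) auto
    also have "\<dots> \<le> (2 ^ i) powr Q / c * (?Y / vol x0 r)"
    proof -
      have "?Y * vol x0 r \<le> ?Y * ((2 ^ i) powr Q / c * vol x (\<sigma> * (r / 2 ^ i)))"
        using v by (intro mult_left_mono) auto
      then show ?thesis using m ball_pos[OF si(1), of x] c_pos by (simp add: field_simps)
    qed
    finally have "dens A x (\<sigma> * (r / 2 ^ i)) powr (1 / p)
        \<le> ((2 ^ i) powr Q / c * (?Y / vol x0 r)) powr (1 / p)"
      using p_gt_1 by (intro powr_mono2 dens_nonneg) auto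
    also have "\<dots> = (2 ^ i) powr (Q / p) / c powr (1 / p) * (?Y / vol x0 r) powr (1 / p)"
      using c_pos by (simp add: powr_mult powr_divide powr_powr)
    finally have "C1 * (r / 2 ^ i) * dens A x (\<sigma> * (r / 2 ^ i)) powr (1 / p) \<le>
        C1 * (r / 2 ^ i) * ((2 ^ i) powr (Q / p) / c powr (1 / p) * (?Y / vol x0 r) powr (1 / p))"
      using C1_pos assms(2) by (intro mult_left_mono) auto
    also have "\<dots> = C1 / c powr (1 / p) * (r * (?Y / vol x0 r) powr (1 / p)) * ((2 ^ i) powr (Q / p) / 2 ^ i)"
      by (simp add: mult_ac)
    also have "r * (?Y / vol x0 r) powr (1 / p) = ?\<gamma> powr (1 / p)"
      using assms(2) p_gt_1 unfolding normalized_energy_def by (subst powr_mult) (auto simp: powr_powr)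
    also have "(2 ^ i) powr (Q / p) / 2 ^ i = b ^ i"
      by (simp add: b_def powr_diff powr_realpow[symmetric] powr_powr power_divide mult.commute)
    finally show ?thesis .
  qed
  have "\<bar>average M (ball x (r / 2 ^ J)) w - average M (ball x r) w\<bar>
      \<le> (\<Sum>i<J. C1 / c powr (1 / p) * ?\<gamma> powr (1 / p) * b ^ i)"
    by (rule order_trans[OF average_telescope[OF assms(1,2)]]) (rule sum_mono, rule step)
  also have "\<dots> = C1 / c powr (1 / p) * ?\<gamma> powr (1 / p) * ((b ^ J - 1) / (b - 1))"
    using b unfolding sum_distrib_left[symmetric] by (simp add: geometric_sum)
  also have "\<dots> \<le> C1 / c powr (1 / p) * ?\<gamma> powr (1 / p) * (b ^ J / (b - 1))"
    using b C1_pos by (intro mult_left_mono divide_right_mono) auto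
  finally show ?thesis by (simp add: mult_ac)
qed

text \<open>At a Lebesgue point outside all the exceptional sets \<open>E i\<close>, three
  contributions of at most \<open>t / 4\<close> each (the average at scale \<open>r\<close>, the
  large scales, the small scales) give \<open>\<bar>w x\<bar> \<le> 3 * t / 4\<close>. So up to a
  null set \<open>F\<close> is covered by the \<open>E i\<close>.\<close>

lemma small_scales:
  fixes x0 w A r J t
  defines "F \<equiv> {x \<in> ball x0 r. t \<le> \<bar>w x\<bar>}"
  assumes w: "poincare_pair w A" "AE x in M. lebesgue_point w x" and r: "0 < r" and t: "0 < t"
    and av: "\<And>x. x \<in> ball x0 r \<Longrightarrow> \<bar>average M (ball x r) w\<bar> \<le> t / 4"
    and large: "\<And>x. x \<in> ball x0 r \<Longrightarrow>
      \<bar>average M (ball x (r / 2 ^ J)) w - average M (ball x r) w\<bar> \<le> t / 4"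
  shows "measure M F \<le> 2 powr Q / c * overlap 2 * (16 * C1) powr p / (1 - (2 / 3) powr p)
    * (r / 2 ^ J / t) powr p * measure N (A \<inter> ball x0 (4 * \<sigma> * r))"
proof -
  let ?Y = "measure N (A \<inter> ball x0 (4 * \<sigma> * r))"
  define s where "s = r / 2 ^ J"
  have s: "0 < s" "s \<le> r" using r by (auto simp: s_def field_simps)
  \<comment> \<open>The thresholds serve two ends. A density at most \<open>l i\<close> makes the
    i-th telescoping step at most \<open>t / 16 * (3 / 4) ^ i\<close>, with total at most
    \<open>t / 4\<close>; and \<open>1 / l i\<close> decays like
    \<open>(2 / 3) powr (p * i)\<close>, so the measures of the exceptional sets are summable. Here
    \<open>3 / 2\<close> is just a ratio strictly between 1 and 2.\<close>
  define l where "l i = (t / (16 * C1 * s) * (3 / 2) ^ i) powr p" for i :: nat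
  have lpos: "l i > 0" for i using t s C1_pos by (simp add: l_def)
  have A: "A \<in> sets M" and wi: "integrable M w" using w by (auto simp: poincare_pair_def)
  have "1 * r \<le> \<sigma> * r" using \<sigma>_ge_1 r by (intro mult_right_mono) auto
  then have sr: "r \<le> \<sigma> * r" by simp
  have "\<exists>E. E \<in> sets M \<and> (\<forall>x. x \<in> ball x0 r \<longrightarrow> l i < dens A x (\<sigma> * (s / 2 ^ i)) \<longrightarrow> x \<in> E)
      \<and> measure M E \<le> 2 powr Q / c * overlap 2 * ?Y / l i" for i
  proof -
    have "s / 2 ^ i \<le> s" using s by (auto simp: field_simps)
    then have "\<sigma> * (s / 2 ^ i) \<le> \<sigma> * r" using \<sigma>_ge_1 s by (intro mult_left_mono) auto
    then have "r + 3 * (\<sigma> * (s / 2 ^ i)) \<le> 4 * \<sigma> * r" using sr by linarith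
    moreover have "0 < \<sigma> * (s / 2 ^ i)" using \<sigma>_ge_1 s by auto
    ultimately show ?thesis
      using density_superlevel_cover[OF A _ lpos] by (metis (no_types, lifting))
  qed
  then obtain E where E: "\<And>i. E i \<in> sets M"
    "\<And>i x. x \<in> ball x0 r \<Longrightarrow> l i < dens A x (\<sigma> * (s / 2 ^ i)) \<Longrightarrow> x \<in> E i"
    "\<And>i. measure M (E i) \<le> 2 powr Q / c * overlap 2 * ?Y / l i" by metis
  define \<theta> :: real where "\<theta> = (2 / 3) powr p"
  have \<theta>: "0 < \<theta>" "\<theta> < 1"
    using p_gt_1 powr_less_mono2[of p "2 / 3" 1] by (auto simp: \<theta>_def)
  define K where "K = 2 powr Q / c * overlap 2 * ?Y * (16 * C1 * s / t) powr p"
  have Ei: "measure M (E i) \<le> K * \<theta> ^ i" for i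
  proof -
    have "1 / l i = (16 * C1 * s / t) powr p * \<theta> ^ i"
      using t s C1_pos
      by (simp add: l_def \<theta>_def powr_mult powr_divide powr_realpow[symmetric] powr_powr field_simps)
    then have "2 powr Q / c * overlap 2 * ?Y / l i = K * \<theta> ^ i"
      by (simp add: K_def divide_inverse mult_ac)
    then show ?thesis using E(3)[of i] by simp
  qed
  have sum\<theta>: "summable (\<lambda>i. K * \<theta> ^ i)" using \<theta> by (intro summable_mult) (simp add: summable_geometric)
  have sumE: "summable (\<lambda>i. measure M (E i))"
    using Ei by (intro summable_comparison_test'[OF sum\<theta>]) auto
  have "AE x in M. x \<in> F \<longrightarrow> x \<in> (\<Union>i. E i)"
    using w(2)
  proof eventually_elim
    fix x assume x: "lebesgue_point w x"
    show "x \<in> F \<longrightarrow> x \<in> (\<Union>i. E i)"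
    proof (intro impI, rule ccontr)
      assume xF: "x \<in> F" and xE: "x \<notin> (\<Union>i. E i)"
      have step: "C1 * (s / 2 ^ i) * dens A x (\<sigma> * (s / 2 ^ i)) powr (1 / p) \<le> t / 16 * (3 / 4) ^ i" for i
      proof -
        have "dens A x (\<sigma> * (s / 2 ^ i)) \<le> l i"
          using E(2)[of x i] xF xE unfolding F_def
          by (metis (no_types, lifting) UN_I UNIV_I mem_Collect_eq not_le)
        then have "dens A x (\<sigma> * (s / 2 ^ i)) powr (1 / p) \<le> l i powr (1 / p)"
          using p_gt_1 by (intro powr_mono2 dens_nonneg) auto
        also have "\<dots> = t / (16 * C1 * s) * (3 / 2) ^ i"
          using p_gt_1 t s C1_pos by (simp add: l_def powr_powr)
        finally have "C1 * (s / 2 ^ i) * dens A x (\<sigma> * (s / 2 ^ i)) powr (1 / p)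
            \<le> C1 * (s / 2 ^ i) * (t / (16 * C1 * s) * (3 / 2) ^ i)"
          using C1_pos s by (intro mult_left_mono) auto
        also have "\<dots> = t / 16 * ((3 / 2) ^ i / 2 ^ i)" using C1_pos s by simp
        also have "(3 / 2) ^ i / 2 ^ i = (3 / 4 :: real) ^ i" by (simp add: power_divide[symmetric])
        finally show ?thesis .
      qed
      have bound: "\<bar>average M (ball x (s / 2 ^ n)) w\<bar> \<le> 3 * t / 4" for n
      proof -
        have "\<bar>average M (ball x (s / 2 ^ n)) w - average M (ball x s) w\<bar>
            \<le> (\<Sum>i<n. t / 16 * (3 / 4) ^ i)"
          by (rule order_trans[OF average_telescope[OF w(1) s(1)]]) (rule sum_mono, rule step)
        also have "\<dots> = t / 16 * (4 * (1 - (3 / 4) ^ n))"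
          unfolding sum_distrib_left[symmetric] by (simp add: sum_gp_strict)
        also have "\<dots> \<le> t / 4" using t by (simp add: field_simps)
        finally have "\<bar>average M (ball x (s / 2 ^ n)) w - average M (ball x s) w\<bar> \<le> t / 4" .
        moreover have "x \<in> ball x0 r" using xF by (simp add: F_def)
        note large[OF this, folded s_def] av[OF this]
        ultimately show ?thesis by linarith
      qed
      have "filterlim (\<lambda>n. s / 2 ^ n) (at_right 0) sequentially"
      proof -
        have "(\<lambda>n. s * (1 / 2) ^ n) \<longlonglongrightarrow> s * 0"
          by (intro tendsto_mult tendsto_const LIMSEQ_power_zero) auto
        then have "(\<lambda>n. s / 2 ^ n) \<longlonglongrightarrow> 0" by (simp add: power_divide)
        then show ?thesis using s by (auto simp: filterlim_at)
      qed
      then have "(\<lambda>n. average M (ball x (s / 2 ^ n)) w) \<longlonglongrightarrow> w x"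
        using lebesgue_point_tendsto[OF wi x] filterlim_compose by blast
      then have "\<bar>w x\<bar> \<le> 3 * t / 4"
        using bound by (intro LIMSEQ_le_const2[OF tendsto_rabs]) auto
      then show False using xF t by (auto simp: F_def)
    qed
  qed
  then have "measure M F \<le> measure M (\<Union>i. E i)"
    using E by (intro finite_measure_mono_AE) auto
  also have "\<dots> \<le> (\<Sum>i. measure M (E i))"
    using E sumE by (intro finite_measure_subadditive_countably) auto
  also have "\<dots> \<le> (\<Sum>i. K * \<theta> ^ i)" using Ei sumE sum\<theta> by (intro suminf_le) auto
  also have "\<dots> = K / (1 - \<theta>)" using \<theta> by (subst suminf_mult) (auto simp: suminf_geometric summable_geometric)
  finally show ?thesis
    using C1_pos s t by (simp add: K_def \<theta>_def s_def powr_mult powr_divide mult_ac)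
qed

text \<open>The Sobolev conjugate of \<open>p\<close> in dimension \<open>Q\<close>.\<close>

definition q :: real where "q = Q * p / (Q - p)"

lemma p_less_q: "p < q"
proof -
  have "p * (Q - p) < Q * p" using p_gt_1 by (simp add: algebra_simps)
  then show ?thesis using p_less_Q by (simp add: q_def field_simps)
qed

text \<open>The large scales may be used down to \<open>r / 2 ^ J\<close> as long as
  \<open>b ^ J * \<gamma> powr (1 / p)\<close> stays below a multiple of \<open>t\<close>. Below
  that scale the bad set has relative measure of order
  \<open>2 powr (- J * p) * \<gamma> / t powr p\<close>. The largest admissible \<open>J\<close>
  makes \<open>2 powr (- J)\<close> of order
  \<open>(\<gamma> powr (1 / p) / t) powr (1 / \<alpha>)\<close>, and the exponents of
  \<open>\<gamma> / t powr p\<close> add up to \<open>1 + 1 / \<alpha> = q / p\<close>.\<close>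

lemma weak_type:
  "\<exists>K>0. \<forall>w A x0 r t. poincare_pair w A \<longrightarrow> (AE x in M. lebesgue_point w x) \<longrightarrow> 0 < r \<longrightarrow> 0 < t \<longrightarrow>
     (\<forall>x\<in>ball x0 r. \<bar>average M (ball x r) w\<bar> \<le> t / 4) \<longrightarrow>
     measure M {x \<in> ball x0 r. t \<le> \<bar>w x\<bar>}
       \<le> K * vol x0 r * (normalized_energy A x0 r / t powr p) powr (q / p)"
proof -
  define \<alpha> where "\<alpha> = Q / p - 1"
  define b where "b = 2 powr \<alpha>"
  have \<alpha>: "\<alpha> > 0" and b: "b > 1" unfolding b_def \<alpha>_def using p_gt_1 p_less_Q by auto
  have exps: "1 + 1 / \<alpha> = q / p" using p_gt_1 p_less_Q by (simp add: \<alpha>_def q_def field_simps)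
  define C3 where "C3 = C1 / c powr (1 / p) / (b - 1)"
  have C3: "C3 > 0" using C1_pos c_pos b by (simp add: C3_def)
  define C4 where "C4 = 2 powr Q / c * overlap 2 * (16 * C1) powr p / (1 - (2 / 3) powr p)"
  have "(2 / 3) powr p < (1 :: real)" using powr_less_mono2[of p "2 / 3" 1] p_gt_1 by simp
  then have C4: "C4 \<ge> 0" using c_pos by (simp add: C4_def overlap_def)
  define K where "K = (4 * C3) powr q + C4 * (2 powr p * (4 * C3) powr (p / \<alpha>))"
  have Kpos: "K > 0" using C3 C4 by (auto simp: K_def intro!: add_pos_nonneg)
  have Kge: "(4 * C3) powr q \<le> K" "C4 * (2 powr p * (4 * C3) powr (p / \<alpha>)) \<le> K"
    using C4 by (auto simp: K_def)
  have "measure M {x \<in> ball x0 r. t \<le> \<bar>w x\<bar>}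
       \<le> K * vol x0 r * (normalized_energy A x0 r / t powr p) powr (q / p)"
    if w: "poincare_pair w A" "AE x in M. lebesgue_point w x" and r: "0 < r" and t: "0 < t"
      and av: "\<forall>x\<in>ball x0 r. \<bar>average M (ball x r) w\<bar> \<le> t / 4" for w A x0 r t
  proof -
    define \<gamma> where "\<gamma> = normalized_energy A x0 r"
    have \<gamma>: "\<gamma> \<ge> 0" by (simp add: \<gamma>_def normalized_energy_nonneg)
    let ?F = "{x \<in> ball x0 r. t \<le> \<bar>w x\<bar>}"
    have m: "vol x0 r > 0" using r by (rule ball_pos)
    have small: "measure M ?F \<le> C4 * ((1 / 2 ^ J) powr p * (\<gamma> / t powr p)) * vol x0 r"
      if "C3 * b ^ J * \<gamma> powr (1 / p) \<le> t / 4" for J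
    proof -
      have "measure M ?F \<le> C4 * (r / 2 ^ J / t) powr p * measure N (A \<inter> ball x0 (4 * \<sigma> * r))"
        unfolding C4_def
      proof (rule small_scales[OF w r t])
        show "\<bar>average M (ball x (r / 2 ^ J)) w - average M (ball x r) w\<bar> \<le> t / 4"
          if "x \<in> ball x0 r" for x
          using average_large_scales[OF w(1) r that, of J] \<open>C3 * b ^ J * \<gamma> powr (1 / p) \<le> t / 4\<close>
          unfolding C3_def b_def \<alpha>_def \<gamma>_def by linarith
      qed (use av in auto)
      also have "\<dots> = C4 * ((1 / 2 ^ J) powr p * (\<gamma> / t powr p)) * vol x0 r"
        using m r t by (simp add: \<gamma>_def normalized_energy_def powr_mult powr_divide field_simps)
      finally show ?thesis .
    qed
    \<comment> \<open>If even \<open>J = 0\<close> is inadmissible, the claimed bound exceeds the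
      whole ball. If \<open>\<gamma> = 0\<close>, every \<open>J\<close> is admissible and there is
      no largest one, but \<open>J = 0\<close> already shows that the set is null.\<close>
    consider "C3 * \<gamma> powr (1 / p) > t / 4" | "\<gamma> = 0" | "\<gamma> > 0" "C3 * \<gamma> powr (1 / p) \<le> t / 4"
      using \<gamma> by fastforce
    then have "measure M ?F \<le> K * vol x0 r * (\<gamma> / t powr p) powr (q / p)"
    proof cases
      case 1
      then have "1 \<le> 4 * C3 * (\<gamma> powr (1 / p) / t)" using t by (simp add: field_simps)
      then have "1 powr q \<le> (4 * C3 * (\<gamma> powr (1 / p) / t)) powr q"
        using p_less_q p_gt_1 by (intro powr_mono2) auto
      also have "\<dots> = (4 * C3) powr q * (\<gamma> / t powr p) powr (q / p)"
        using C3 \<gamma> t p_gt_1 by (simp add: powr_mult powr_divide powr_powr)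
      also have "\<dots> \<le> K * (\<gamma> / t powr p) powr (q / p)" using Kge by (intro mult_right_mono) auto
      finally have "1 \<le> K * (\<gamma> / t powr p) powr (q / p)" by simp
      then have "vol x0 r * 1 \<le> vol x0 r * (K * (\<gamma> / t powr p) powr (q / p))"
        using m by (intro mult_left_mono) auto
      moreover have "measure M ?F \<le> vol x0 r" by (intro finite_measure_mono) auto
      ultimately show ?thesis by (simp add: mult_ac)
    next
      case 2
      then have "measure M ?F \<le> 0" using small[of 0] t by simp
      then show ?thesis using m Kpos by (auto intro: order_trans)
    next
      case 3
      define X where "X = 4 * C3 * (\<gamma> powr (1 / p) / t)"
      have X: "X > 0" using 3 C3 t by (simp add: X_def)
      \<comment> \<open>\<open>X * b ^ J \<le> 1\<close> says that the large scales contribute at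
        most \<open>t / 4\<close>. As \<open>b > 1\<close> this fails eventually, so there is a last
        \<open>J\<close>; its failure at \<open>Suc J\<close> bounds \<open>1 / 2 ^ J\<close> from
        above.\<close>
      obtain n where "1 / X < b ^ n" using real_arch_pow[OF b] by blast
      then have "\<not> X * b ^ n \<le> 1" using X by (simp add: field_simps)
      moreover have "X * b ^ 0 \<le> 1" using 3 t by (simp add: X_def field_simps)
      ultimately obtain J where J: "X * b ^ J \<le> 1" "\<not> X * b ^ Suc J \<le> 1"
        using nat_induct[of "\<lambda>J. X * b ^ J \<le> 1" n] by blast
      have "measure M ?F \<le> C4 * ((1 / 2 ^ J) powr p * (\<gamma> / t powr p)) * vol x0 r"
        using J(1) t by (intro small) (simp add: X_def field_simps)
      also have "(1 / 2 ^ J) powr p \<le> (2 * X powr (1 / \<alpha>)) powr p"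
      proof (rule powr_mono2)
        have "1 powr (1 / \<alpha>) \<le> (X * b ^ Suc J) powr (1 / \<alpha>)"
          using J(2) \<alpha> by (intro powr_mono2) auto
        also have "\<dots> = X powr (1 / \<alpha>) * 2 ^ Suc J"
          using \<alpha> X b by (simp add: b_def powr_mult powr_powr powr_realpow[symmetric] mult.commute)
        finally show "1 / 2 ^ J \<le> 2 * X powr (1 / \<alpha>)" by (simp add: field_simps)
      qed (use p_gt_1 in auto)
      also have "(2 * X powr (1 / \<alpha>)) powr p = 2 powr p * (4 * C3) powr (p / \<alpha>) * (\<gamma> / t powr p) powr (1 / \<alpha>)"
        using C3 3 t p_gt_1 by (simp add: X_def powr_mult powr_divide powr_powr)
      finally have "measure M ?F \<le> C4 * (2 powr p * (4 * C3) powr (p / \<alpha>) * (\<gamma> / t powr p) powr (1 / \<alpha>) * (\<gamma> / t powr p)) * vol x0 r"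
        using C4 \<gamma> m by (simp add: mult_left_mono mult_right_mono divide_right_mono)
      also have "\<dots> = C4 * (2 powr p * (4 * C3) powr (p / \<alpha>)) * vol x0 r * ((\<gamma> / t powr p) powr 1 * (\<gamma> / t powr p) powr (1 / \<alpha>))"
        using 3 t by simp
      also have "(\<gamma> / t powr p) powr 1 * (\<gamma> / t powr p) powr (1 / \<alpha>) = (\<gamma> / t powr p) powr (q / p)"
        using exps by (simp only: powr_add[symmetric])
      also have "C4 * (2 powr p * (4 * C3) powr (p / \<alpha>)) * vol x0 r * (\<gamma> / t powr p) powr (q / p)
          \<le> K * vol x0 r * (\<gamma> / t powr p) powr (q / p)"
        using Kge m by (intro mult_right_mono) auto
      finally show ?thesis .
    qed
    then show ?thesis by (simp add: \<gamma>_def)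
  qed
  then show ?thesis using Kpos by blast
qed

end

section \<open>Sobolev--Poincare inequality and oscillations\<close>

text \<open>All that is retained of the upper gradient of \<open>v\<close>: the Poincare inequality
  for \<open>v\<close> and for its truncations, the latter with gradients living on level
  sets.\<close>

locale sobolev_function = poincare_setting M N c Q p \<sigma> C
  for M N :: "'a::metric_space measure" and c Q p \<sigma> C +
  fixes v :: "'a \<Rightarrow> real"
  assumes poincare_v: "poincare_pair v UNIV"
    and poincare_truncation: "0 < t \<Longrightarrow>
      poincare_pair (\<lambda>x. min (max (\<bar>v x - a\<bar> - t) 0) t) {x. t < \<bar>v x - a\<bar> \<and> \<bar>v x - a\<bar> < 2 * t}"
begin

abbreviation energy :: "'a \<Rightarrow> real \<Rightarrow> real" where
  "energy \<equiv> normalized_energy UNIV"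

text \<open>The doubled radius is chosen because \<open>ball x r \<subseteq> ball z (2 * r)\<close>
  for every \<open>x\<close> in \<open>ball z r\<close>, so one reference value serves all these
  balls.\<close>

definition center :: "'a \<Rightarrow> real \<Rightarrow> real" where
  "center z r = average M (ball z (2 * r)) v"

text \<open>The Sobolev--Poincare inequality with exponent \<open>e\<close> on the left, raised to
  the power \<open>e\<close>.\<close>

definition deviation_bound :: "real \<Rightarrow> bool" where
  "deviation_bound e \<longleftrightarrow> (\<exists>K>0. \<forall>z r. 0 < r \<longrightarrow>
     (\<integral>\<^sup>+y\<in>ball z r. ennreal (\<bar>v y - center z r\<bar> powr e) \<partial>M)
       \<le> ennreal (K * vol z r * energy z r powr (e / p)))"

section \<open>From deviation bounds on balls to pointwise bounds and Lebesgue points\<close>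

lemma integrable_v [simp]: "integrable M v"
  using poincare_v by (simp add: poincare_pair_def)

lemma measurable_v [measurable]: "v \<in> borel_measurable M"
  using integrable_v by blast

lemma vol_le_N: "0 < r \<Longrightarrow> vol z r \<le> measure N (ball z (4 * \<sigma> * r))"
proof -
  assume r: "0 < r"
  have "1 * r \<le> (4 * \<sigma>) * r" using r \<sigma>_ge_1 by (intro mult_right_mono) auto
  then have "vol z r \<le> vol z (4 * \<sigma> * r)" by (intro vol_mono_radius) simp
  also have "\<dots> \<le> measure N (ball z (4 * \<sigma> * r))" by (intro measure_le_N) simp
  finally show ?thesis .
qed

lemma energy_pos: "0 < r \<Longrightarrow> 0 < energy z r"
  using ball_pos[of r z] vol_le_N[of r z] by (auto simp: normalized_energy_def)

lemma deviation_double_ball: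
  assumes "0 < r"
  shows "(LINT y:ball z (2 * r)|M. \<bar>v y - center z r\<bar>) \<le> 2 * C * (2 powr Q / c) * vol z r * energy z r powr (1 / p)"
proof -
  have "1 * (2 * r) \<le> \<sigma> * (2 * r)" using assms \<sigma>_ge_1 by (intro mult_right_mono) auto
  then have sr: "r \<le> \<sigma> * (2 * r)" using assms by linarith
  have "dens UNIV z (\<sigma> * (2 * r)) \<le> measure N (ball z (4 * \<sigma> * r)) / vol z r"
    unfolding dens_def using sr ball_pos[OF assms] assms \<sigma>_ge_1 sets_N
    by (intro frac_le N.finite_measure_mono vol_mono_radius) (auto intro!: subset_ball)
  then have "dens UNIV z (\<sigma> * (2 * r)) powr (1 / p) \<le> (measure N (ball z (4 * \<sigma> * r)) / vol z r) powr (1 / p)"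
    using p_gt_1 by (intro powr_mono2 dens_nonneg) auto
  moreover have "energy z r powr (1 / p) = r * (measure N (ball z (4 * \<sigma> * r)) / vol z r) powr (1 / p)"
    unfolding normalized_energy_def using assms p_gt_1 by (subst powr_mult) (auto simp: powr_powr)
  ultimately have d: "r * dens UNIV z (\<sigma> * (2 * r)) powr (1 / p) \<le> energy z r powr (1 / p)"
    using assms by simp
  have "(LINT y:ball z (2 * r)|M. \<bar>v y - center z r\<bar>)
      \<le> C * (2 * r) * vol z (2 * r) * dens UNIV z (\<sigma> * (2 * r)) powr (1 / p)"
    using poincare_v assms by (simp add: poincare_pair_def center_def)
  also have "\<dots> = 2 * C * vol z (2 * r) * (r * dens UNIV z (\<sigma> * (2 * r)) powr (1 / p))" by simp
  also have "\<dots> \<le> 2 * C * ((2 powr Q / c) * vol z r) * energy z r powr (1 / p)"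
    using C_pos c_pos assms d dens_nonneg by (intro mult_mono vol_le_shrunk) auto
  finally show ?thesis by (simp add: mult_ac)
qed

lemma deviation_bound_1: "deviation_bound 1"
  unfolding deviation_bound_def
proof (intro exI[of _ "2 * C * (2 powr Q / c)"] conjI allI impI)
  fix z r assume r: "0 < (r :: real)"
  have "(\<integral>\<^sup>+y\<in>ball z r. ennreal (\<bar>v y - center z r\<bar> powr 1) \<partial>M) = ennreal (LINT y:ball z r|M. \<bar>v y - center z r\<bar>)"
    by (simp add: nn_integral_set_eq_integral)
  also have "(LINT y:ball z r|M. \<bar>v y - center z r\<bar>) \<le> (LINT y:ball z (2 * r)|M. \<bar>v y - center z r\<bar>)"
    using r by (intro set_integral_mono_set) auto
  also have "\<dots> \<le> 2 * C * (2 powr Q / c) * vol z r * energy z r powr (1 / p)"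
    by (rule deviation_double_ball[OF r])
  finally show "(\<integral>\<^sup>+y\<in>ball z r. ennreal (\<bar>v y - center z r\<bar> powr 1) \<partial>M)
      \<le> ennreal (2 * C * (2 powr Q / c) * vol z r * energy z r powr (1 / p))"
    by (simp add: ennreal_leI)
qed (use C_pos c_pos in auto)

text \<open>The density \<rho> is at least 1 because \<open>N\<close> dominates \<open>M\<close>, so
  \<open>\<rho> powr (s / p) \<le> \<rho>\<close>. The resulting bound is linear in \<open>N\<close>
  and can be summed over a cover.\<close>

lemma energy_powr_vol_le:
  assumes "0 < r" "0 < s" "s \<le> p"
  shows "energy z r powr (s / p) * vol z r \<le> r powr s * measure N (ball z (4 * \<sigma> * r))"
proof -
  define \<rho> where "\<rho> = measure N (ball z (4 * \<sigma> * r)) / vol z r"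
  have m: "0 < vol z r" using assms by (intro ball_pos)
  then have "\<rho> \<ge> 1" using vol_le_N[OF assms(1)] by (simp add: \<rho>_def)
  then have "\<rho> powr (s / p) \<le> \<rho> powr 1" using assms p_gt_1 by (intro powr_mono) auto
  then have *: "\<rho> powr (s / p) \<le> \<rho>" using \<open>\<rho> \<ge> 1\<close> by simp
  have "energy z r powr (s / p) = r powr s * \<rho> powr (s / p)"
    using assms p_gt_1 unfolding normalized_energy_def \<rho>_def by (subst powr_mult) (auto simp: powr_powr)
  also have "\<dots> * vol z r \<le> r powr s * \<rho> * vol z r"
    using * m by (intro mult_right_mono mult_left_mono) auto
  finally show ?thesis using m by (simp add: \<rho>_def)
qed

text \<open>Both \<open>v\<close> on \<open>ball x r'\<close> and the value \<open>v x\<close> are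
  compared with the reference value \<open>a z\<close> of one net point \<open>z\<close> near
  \<open>x\<close>. \<open>F\<close> collects the energy at \<open>z\<close> and the deviation of
  \<open>v x\<close> from \<open>a z\<close>. It depends on \<open>r\<close> only, so it serves a
  whole dyadic range of radii. The exponent \<open>h\<close> belongs to the pointwise bound, and
  \<open>s \<le> p\<close> to the integral that is summed over the net.\<close>

lemma pointwise_deviation_cover:
  assumes "deviation_bound h" "deviation_bound s" "0 < h" "0 < s" "s \<le> p"
  shows "\<exists>K>0. \<forall>r>0. \<exists>F. F \<in> borel_measurable M \<and> (\<forall>x. 0 \<le> F x) \<and>
    (\<forall>x r'. r / 2 \<le> r' \<longrightarrow> r' \<le> r \<longrightarrow>
      (\<integral>\<^sup>+y\<in>ball x r'. ennreal (\<bar>v y - v x\<bar> powr h) \<partial>M) \<le> ennreal (K * vol x r' * F x powr (h / s))) \<and>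
    (\<integral>\<^sup>+x. ennreal (F x) \<partial>M) \<le> ennreal (K * r powr s)"
proof -
  obtain Kh where Kh: "Kh > 0" "\<And>z r. 0 < r \<Longrightarrow>
     (\<integral>\<^sup>+y\<in>ball z r. ennreal (\<bar>v y - center z r\<bar> powr h) \<partial>M) \<le> ennreal (Kh * vol z r * energy z r powr (h / p))"
    using assms(1) by (auto simp: deviation_bound_def)
  obtain Ks where Ks: "Ks > 0" "\<And>z r. 0 < r \<Longrightarrow>
     (\<integral>\<^sup>+y\<in>ball z r. ennreal (\<bar>v y - center z r\<bar> powr s) \<partial>M) \<le> ennreal (Ks * vol z r * energy z r powr (s / p))"
    using assms(2) by (auto simp: deviation_bound_def)
  \<comment> \<open>\<open>K1\<close> is for the pointwise bound, \<open>K2\<close> for the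
    integral. The 4 in \<open>K1\<close> is the ratio of the radius \<open>2 * r\<close> at the net
    point to the least \<open>r'\<close>, which is \<open>r / 2\<close>; in \<open>K2\<close>,
    \<open>8 * \<sigma>\<close> is the dilation \<open>4 * \<sigma>\<close> of the energy at radius
    \<open>2 * r\<close>.\<close>
  define K1 where "K1 = 2 powr h * (Kh * (4 powr Q / c) + 1)"
  define K2 where "K2 = (1 + Ks) * (2 powr s * overlap (8 * \<sigma>) * measure N UNIV)"
  have K1: "K1 > 0" using Kh c_pos by (auto simp: K1_def intro!: mult_pos_pos add_pos_pos)
  have K2: "K2 \<ge> 0" using Ks c_pos by (auto simp: K2_def overlap_def)
  show ?thesis
  proof (intro exI[of _ "K1 + K2"] conjI allI impI)
    show "0 < K1 + K2" using K1 K2 by simp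
    fix r :: real assume r: "0 < r"
    obtain S :: "'a set" where S: "finite S" "\<And>x. \<exists>z\<in>S. dist z x < r"
      "\<And>x k. 1 \<le> k \<Longrightarrow> real (card {z \<in> S. dist z x < k * r}) \<le> overlap k"
      using finite_net[OF r] by blast
    define G where "G z = energy z (2 * r) powr (s / p)" for z
    define a where "a z = center z (2 * r)" for z
    \<comment> \<open>Summing over all net points near \<open>x\<close>, instead of choosing one,
      keeps \<open>F\<close> measurable; bounded overlap pays for it.\<close>
    define F where "F x = (\<Sum>z\<in>S. indicator (ball z r) x * (G z + \<bar>v x - a z\<bar> powr s))" for x
    have F0: "0 \<le> F x" for x unfolding F_def G_def by (intro sum_nonneg) auto
    show "\<exists>F. F \<in> borel_measurable M \<and> (\<forall>x. 0 \<le> F x) \<and>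
      (\<forall>x r'. r / 2 \<le> r' \<longrightarrow> r' \<le> r \<longrightarrow>
        (\<integral>\<^sup>+y\<in>ball x r'. ennreal (\<bar>v y - v x\<bar> powr h) \<partial>M)
          \<le> ennreal ((K1 + K2) * vol x r' * F x powr (h / s))) \<and>
      (\<integral>\<^sup>+x. ennreal (F x) \<partial>M) \<le> ennreal ((K1 + K2) * r powr s)"
    proof (intro exI[of _ F] conjI allI impI F0)
      show "F \<in> borel_measurable M" unfolding F_def by measurable
      show "(\<integral>\<^sup>+y\<in>ball x r'. ennreal (\<bar>v y - v x\<bar> powr h) \<partial>M)
          \<le> ennreal ((K1 + K2) * vol x r' * F x powr (h / s))" if r': "r / 2 \<le> r'" "r' \<le> r" for x r'
      proof -
        obtain z where z: "z \<in> S" "dist z x < r" using S by blast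
        have "G z + \<bar>v x - a z\<bar> powr s = indicator (ball z r) x * (G z + \<bar>v x - a z\<bar> powr s)"
          using z by simp
        also have "\<dots> \<le> F x"
          unfolding F_def G_def using z S by (intro member_le_sum) auto
        finally have Fge: "G z + \<bar>v x - a z\<bar> powr s \<le> F x" .
        have "0 \<le> G z" by (simp add: G_def)
        have "energy z (2 * r) powr (h / p) = G z powr (h / s)"
          using assms by (simp add: G_def powr_powr)
        also have "\<dots> \<le> F x powr (h / s)"
          using assms Fge by (intro powr_mono2) (auto simp: G_def intro: order_trans[rotated])
        finally have e1: "energy z (2 * r) powr (h / p) \<le> F x powr (h / s)" .
        have "\<bar>v x - a z\<bar> powr h = (\<bar>v x - a z\<bar> powr s) powr (h / s)"
          using assms by (simp add: powr_powr)
        also have "\<dots> \<le> F x powr (h / s)"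
          using assms Fge \<open>0 \<le> G z\<close> by (intro powr_mono2) auto
        finally have e2: "\<bar>v x - a z\<bar> powr h \<le> F x powr (h / s)" .
        have sub: "ball x r' \<subseteq> ball z (2 * r)"
        proof
          fix y assume "y \<in> ball x r'"
          then show "y \<in> ball z (2 * r)" using z r' dist_triangle[of z y x] by simp
        qed
        have vz: "vol z (2 * r) \<le> (4 powr Q / c) * vol x r'"
          using z r' r by (intro vol_le_shrunk) auto
        have "(\<integral>\<^sup>+y\<in>ball x r'. ennreal (\<bar>v y - v x\<bar> powr h) \<partial>M)
          \<le> (\<integral>\<^sup>+y. ennreal (2 powr h) * (ennreal (\<bar>v y - a z\<bar> powr h) * indicator (ball z (2 * r)) y)
              + ennreal (2 powr h * \<bar>v x - a z\<bar> powr h) * indicator (ball x r') y \<partial>M)"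
        proof (intro nn_integral_mono)
          fix y
          show "ennreal (\<bar>v y - v x\<bar> powr h) * indicator (ball x r') y
            \<le> ennreal (2 powr h) * (ennreal (\<bar>v y - a z\<bar> powr h) * indicator (ball z (2 * r)) y)
              + ennreal (2 powr h * \<bar>v x - a z\<bar> powr h) * indicator (ball x r') y"
          proof (cases "y \<in> ball x r'")
            case True
            then have yz: "y \<in> ball z (2 * r)" using sub by blast
            have "\<bar>v y - v x\<bar> powr h \<le> (\<bar>v y - a z\<bar> + \<bar>v x - a z\<bar>) powr h"
              using assms by (intro powr_mono2) auto
            also have "\<dots> \<le> 2 powr h * \<bar>v y - a z\<bar> powr h + 2 powr h * \<bar>v x - a z\<bar> powr h"
              using powr_add_le[of "\<bar>v y - a z\<bar>" "\<bar>v x - a z\<bar>" h] assms by (simp add: algebra_simps)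
            finally show ?thesis using True yz
              by (simp add: ennreal_mult[symmetric] ennreal_plus[symmetric] del: ennreal_plus)
          qed simp
        qed
        also have "\<dots> = ennreal (2 powr h) * (\<integral>\<^sup>+y\<in>ball z (2 * r). ennreal (\<bar>v y - a z\<bar> powr h) \<partial>M)
            + ennreal (2 powr h * \<bar>v x - a z\<bar> powr h) * emeasure M (ball x r')"
          by (subst nn_integral_add) (auto simp: nn_integral_cmult)
        also have "\<dots> \<le> ennreal (2 powr h) * ennreal (Kh * vol z (2 * r) * energy z (2 * r) powr (h / p))
            + ennreal (2 powr h * \<bar>v x - a z\<bar> powr h) * ennreal (vol x r')"
          unfolding a_def using Kh(2)[of "2 * r" z] r by (intro add_mono mult_left_mono) (auto simp: emeasure_eq_measure)
        also have "\<dots> = ennreal (2 powr h * (Kh * vol z (2 * r) * energy z (2 * r) powr (h / p))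
            + 2 powr h * \<bar>v x - a z\<bar> powr h * vol x r')"
          using Kh by (simp add: ennreal_mult[symmetric] ennreal_plus[symmetric] del: ennreal_plus)
        also have "2 powr h * (Kh * vol z (2 * r) * energy z (2 * r) powr (h / p))
            + 2 powr h * \<bar>v x - a z\<bar> powr h * vol x r'
            \<le> 2 powr h * (Kh * ((4 powr Q / c) * vol x r') * F x powr (h / s)) + 2 powr h * F x powr (h / s) * vol x r'"
          using Kh e1 e2 vz c_pos by (intro add_mono mult_left_mono mult_mono mult_right_mono) auto
        also have "\<dots> = K1 * (vol x r' * F x powr (h / s))" by (simp add: K1_def algebra_simps)
        also have "\<dots> \<le> (K1 + K2) * (vol x r' * F x powr (h / s))"
          using K2 by (intro mult_right_mono) auto
        finally show ?thesis by (simp add: ennreal_leI mult_ac)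
      qed
      have "(\<integral>\<^sup>+x. ennreal (F x) \<partial>M) = (\<integral>\<^sup>+x. (\<Sum>z\<in>S. ennreal (G z) * indicator (ball z r) x
          + ennreal (\<bar>v x - a z\<bar> powr s) * indicator (ball z r) x) \<partial>M)"
      proof (rule nn_integral_cong)
        fix x
        show "ennreal (F x) = (\<Sum>z\<in>S. ennreal (G z) * indicator (ball z r) x
          + ennreal (\<bar>v x - a z\<bar> powr s) * indicator (ball z r) x)"
        proof -
          have "ennreal (F x) = (\<Sum>z\<in>S. ennreal (indicator (ball z r) x * (G z + \<bar>v x - a z\<bar> powr s)))"
            unfolding F_def by (rule sum_ennreal[symmetric]) (auto simp: G_def)
          also have "\<dots> = (\<Sum>z\<in>S. ennreal (G z) * indicator (ball z r) x
            + ennreal (\<bar>v x - a z\<bar> powr s) * indicator (ball z r) x)"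
            by (intro sum.cong refl) (auto simp: G_def indicator_def)
          finally show ?thesis .
        qed
      qed
      also have "\<dots> = (\<Sum>z\<in>S. ennreal (G z) * emeasure M (ball z r)
          + (\<integral>\<^sup>+x\<in>ball z r. ennreal (\<bar>v x - a z\<bar> powr s) \<partial>M))"
        by (subst nn_integral_sum) (auto intro!: sum.cong simp: nn_integral_add nn_integral_cmult)
      also have "\<dots> \<le> (\<Sum>z\<in>S. ennreal ((1 + Ks) * (2 powr s * r powr s * measure N (ball z (8 * \<sigma> * r)))))"
      proof (rule sum_mono)
        fix z
        have "(\<integral>\<^sup>+x\<in>ball z r. ennreal (\<bar>v x - a z\<bar> powr s) \<partial>M)
            \<le> (\<integral>\<^sup>+x\<in>ball z (2 * r). ennreal (\<bar>v x - a z\<bar> powr s) \<partial>M)"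
          using r by (intro nn_integral_mono) (auto simp: indicator_def)
        also have "\<dots> \<le> ennreal (Ks * vol z (2 * r) * G z)"
          unfolding a_def G_def using r by (intro Ks) auto
        finally have i: "(\<integral>\<^sup>+x\<in>ball z r. ennreal (\<bar>v x - a z\<bar> powr s) \<partial>M) \<le> ennreal (Ks * vol z (2 * r) * G z)" .
        have G0: "0 \<le> G z" by (simp add: G_def)
        have "vol z r \<le> vol z (2 * r)" using r by (intro vol_mono_radius) auto
        then have g: "ennreal (G z) * emeasure M (ball z r) \<le> ennreal (G z * vol z (2 * r))"
          using G0 by (simp add: emeasure_eq_measure ennreal_mult[symmetric] mult_left_mono ennreal_leI)
        have "ennreal (G z) * emeasure M (ball z r) + (\<integral>\<^sup>+x\<in>ball z r. ennreal (\<bar>v x - a z\<bar> powr s) \<partial>M)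
            \<le> ennreal (G z * vol z (2 * r)) + ennreal (Ks * vol z (2 * r) * G z)"
          by (intro add_mono i g)
        also have "\<dots> = ennreal ((1 + Ks) * (G z * vol z (2 * r)))"
          using G0 Ks by (simp add: ennreal_plus[symmetric] algebra_simps del: ennreal_plus)
        also have "\<dots> \<le> ennreal ((1 + Ks) * ((2 * r) powr s * measure N (ball z (4 * \<sigma> * (2 * r)))))"
          unfolding G_def using Ks assms r by (intro ennreal_leI mult_left_mono energy_powr_vol_le) auto
        finally show "ennreal (G z) * emeasure M (ball z r) + (\<integral>\<^sup>+x\<in>ball z r. ennreal (\<bar>v x - a z\<bar> powr s) \<partial>M)
            \<le> ennreal ((1 + Ks) * (2 powr s * r powr s * measure N (ball z (8 * \<sigma> * r))))"
          using r by (simp add: powr_mult mult_ac)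
      qed
      also have "\<dots> = ennreal ((1 + Ks) * (2 powr s * r powr s * (\<Sum>z\<in>S. measure N (ball z (8 * \<sigma> * r)))))"
        using Ks by (subst sum_ennreal) (auto simp: sum_distrib_left)
      also have "(\<Sum>z\<in>S. measure N (ball z (8 * \<sigma> * r))) \<le> overlap (8 * \<sigma>) * measure N UNIV"
        using S(1) S(3)[of "8 * \<sigma>"] \<sigma>_ge_1 sets_N sets.top[of M] space_UNIV
        by (intro sum_measure_overlap_le N.finite_measure_axioms) auto
      finally have "(\<integral>\<^sup>+x. ennreal (F x) \<partial>M) \<le> ennreal ((1 + Ks) * (2 powr s * r powr s * (overlap (8 * \<sigma>) * measure N UNIV)))"
        using Ks by (auto simp: ennreal_leI mult_left_mono)
      also have "\<dots> = ennreal (K2 * r powr s)" by (simp add: K2_def mult_ac)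
      also have "\<dots> \<le> ennreal ((K1 + K2) * r powr s)" using K1 by (intro ennreal_leI mult_right_mono) auto
      finally show "(\<integral>\<^sup>+x. ennreal (F x) \<partial>M) \<le> ennreal ((K1 + K2) * r powr s)" .
    qed
  qed
qed

text \<open>With both exponents 1 the functions \<open>F k\<close> at radii
  \<open>(1 / 2) ^ k\<close> have integrals bounded by a geometric sequence. Hence their sum is
  finite almost everywhere, the terms tend to 0, and they dominate the mean deviations from
  \<open>v x\<close>.\<close>

lemma AE_lebesgue_point: "AE x in M. lebesgue_point v x"
proof -
  obtain K where K: "K > 0" "\<And>r. r > 0 \<Longrightarrow> \<exists>F. F \<in> borel_measurable M \<and> (\<forall>x. 0 \<le> F x) \<and>
    (\<forall>x r'. r / 2 \<le> r' \<longrightarrow> r' \<le> r \<longrightarrow>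
      (\<integral>\<^sup>+y\<in>ball x r'. ennreal (\<bar>v y - v x\<bar> powr 1) \<partial>M) \<le> ennreal (K * vol x r' * F x powr (1 / 1))) \<and>
    (\<integral>\<^sup>+x. ennreal (F x) \<partial>M) \<le> ennreal (K * r powr 1)"
    using pointwise_deviation_cover[OF deviation_bound_1 deviation_bound_1] p_gt_1 by auto
  define P where "P k F \<longleftrightarrow> F \<in> borel_measurable M \<and> (\<forall>x. 0 \<le> F x) \<and>
    (\<forall>x r'. (1 / 2) ^ Suc k \<le> r' \<longrightarrow> r' \<le> (1 / 2) ^ k \<longrightarrow>
      (\<integral>\<^sup>+y\<in>ball x r'. ennreal \<bar>v y - v x\<bar> \<partial>M) \<le> ennreal (K * vol x r' * F x)) \<and>
    (\<integral>\<^sup>+x. ennreal (F x) \<partial>M) \<le> ennreal (K * (1 / 2) ^ k)" for k :: nat and F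
  have "\<exists>F. P k F" for k
  proof -
    obtain F where "F \<in> borel_measurable M" "\<forall>x. 0 \<le> F x"
      "\<forall>x r'. (1 / 2) ^ k / 2 \<le> r' \<longrightarrow> r' \<le> (1 / 2) ^ k \<longrightarrow>
      (\<integral>\<^sup>+y\<in>ball x r'. ennreal (\<bar>v y - v x\<bar> powr 1) \<partial>M) \<le> ennreal (K * vol x r' * F x powr (1 / 1))"
      "(\<integral>\<^sup>+x. ennreal (F x) \<partial>M) \<le> ennreal (K * ((1 / 2) ^ k) powr 1)"
      using K(2)[of "(1 / 2) ^ k"] by auto
    then show ?thesis by (intro exI[of _ F]) (auto simp: P_def)
  qed
  then obtain F where "\<And>k. P k (F k)" by metis
  then have F: "\<And>k. F k \<in> borel_measurable M" "\<And>k x. 0 \<le> F k x"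
    "\<And>k x r'. (1 / 2) ^ Suc k \<le> r' \<Longrightarrow> r' \<le> (1 / 2) ^ k \<Longrightarrow>
      (\<integral>\<^sup>+y\<in>ball x r'. ennreal \<bar>v y - v x\<bar> \<partial>M) \<le> ennreal (K * vol x r' * F k x)"
    "\<And>k. (\<integral>\<^sup>+x. ennreal (F k x) \<partial>M) \<le> ennreal (K * (1 / 2) ^ k)" by (auto simp: P_def)
  note F(1)[measurable]
  have "(\<integral>\<^sup>+x. (\<Sum>k. ennreal (F k x)) \<partial>M) = (\<Sum>k. \<integral>\<^sup>+x. ennreal (F k x) \<partial>M)"
    by (intro nn_integral_suminf) measurable
  also have "\<dots> \<le> (\<Sum>k. ennreal (K * (1 / 2) ^ k))" using F(4) by (intro suminf_le) auto
  also have "\<dots> = ennreal (\<Sum>k. K * (1 / 2) ^ k)"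
    using K(1) by (intro suminf_ennreal2 summable_mult summable_geometric) auto
  finally have "(\<integral>\<^sup>+x. (\<Sum>k. ennreal (F k x)) \<partial>M) \<noteq> \<infinity>" by (auto simp: top_unique)
  then have "AE x in M. (\<Sum>k. ennreal (F k x)) \<noteq> \<infinity>"
    by (intro nn_integral_noteq_infinite) auto
  then show ?thesis
  proof eventually_elim
    fix x assume "(\<Sum>k. ennreal (F k x)) \<noteq> \<infinity>"
    then have "summable (\<lambda>k. F k x)" using F(2) by (intro summable_suminf_not_top) auto
    then have lim: "(\<lambda>k. F k x) \<longlonglongrightarrow> 0" by (rule summable_LIMSEQ_zero)
    show "lebesgue_point v x"
      unfolding lebesgue_point_def
    proof (rule tendstoI)
      fix e :: real assume "0 < e"
      then have "0 < e / K" using K by simp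
      then obtain k0 where k0: "\<And>k. k \<ge> k0 \<Longrightarrow> F k x < e / K"
        using order_tendstoD(2)[OF lim] by (auto simp: eventually_sequentially)
      show "eventually (\<lambda>r. dist (average M (ball x r) (\<lambda>y. \<bar>v y - v x\<bar>)) 0 < e) (at_right 0)"
        unfolding eventually_at_right_field
      proof (intro exI[of _ "(1 / 2) ^ k0"] conjI allI impI)
        fix r :: real assume r: "0 < r" "r < (1 / 2) ^ k0"
        obtain n :: nat where "(1 / 2) ^ n < r" using real_arch_pow_inv[OF r(1), of "1 / 2"] by auto
        then have ex: "\<exists>n. (1 / 2) ^ n < r" by blast
        \<comment> \<open>The predecessor \<open>k\<close> of this least index is the dyadic range
          containing \<open>r\<close>.\<close>
        define m where "m = (LEAST n. (1 / 2) ^ n < r)"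
        have m: "(1 / 2) ^ m < r" using ex unfolding m_def by (rule LeastI_ex)
        have "m > k0"
        proof (rule ccontr)
          assume "\<not> m > k0"
          then have "(1 / 2 :: real) ^ k0 \<le> (1 / 2) ^ m" by (intro power_decreasing) auto
          then show False using m r by linarith
        qed
        then obtain k where k: "m = Suc k" "k \<ge> k0" by (cases m) auto
        have "\<not> (1 / 2) ^ k < r"
          using k(1) not_less_Least[of k "\<lambda>n. (1 / 2) ^ n < r"] by (simp add: m_def)
        then have "(\<integral>\<^sup>+y\<in>ball x r. ennreal \<bar>v y - v x\<bar> \<partial>M) \<le> ennreal (K * vol x r * F k x)"
          using m k by (intro F(3)) auto
        also have "(\<integral>\<^sup>+y\<in>ball x r. ennreal \<bar>v y - v x\<bar> \<partial>M) = ennreal (LINT y:ball x r|M. \<bar>v y - v x\<bar>)"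
          by (intro nn_integral_set_eq_integral) auto
        finally have "(LINT y:ball x r|M. \<bar>v y - v x\<bar>) \<le> K * vol x r * F k x"
          using K F(2) by (subst (asm) ennreal_le_iff) auto
        then have "average M (ball x r) (\<lambda>y. \<bar>v y - v x\<bar>) \<le> K * F k x"
          using ball_pos[OF r(1), of x] by (simp add: average_def field_simps)
        also have "\<dots> < e" using k0[OF k(2)] K by (simp add: field_simps)
        finally have "average M (ball x r) (\<lambda>y. \<bar>v y - v x\<bar>) < e" .
        moreover have "0 \<le> average M (ball x r) (\<lambda>y. \<bar>v y - v x\<bar>)"
          unfolding average_def set_lebesgue_integral_def
          by (intro divide_nonneg_nonneg integral_nonneg) (auto simp: indicator_def)
        ultimately show "dist (average M (ball x r) (\<lambda>y. \<bar>v y - v x\<bar>)) 0 < e" by simp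
      qed simp
    qed
  qed
qed

lemma lebesgue_point_lipschitz:
  assumes "lebesgue_point v x" "integrable M w" "\<And>y. \<bar>w y - w x\<bar> \<le> \<bar>v y - v x\<bar>"
  shows "lebesgue_point w x"
  unfolding lebesgue_point_def
proof (rule tendsto_sandwich[where f = "\<lambda>_. 0" and h = "\<lambda>r. average M (ball x r) (\<lambda>y. \<bar>v y - v x\<bar>)"])
  show "((\<lambda>r. average M (ball x r) (\<lambda>y. \<bar>v y - v x\<bar>)) \<longlongrightarrow> 0) (at_right 0)"
    using assms(1) by (simp add: lebesgue_point_def)
  show "eventually (\<lambda>r. 0 \<le> average M (ball x r) (\<lambda>y. \<bar>w y - w x\<bar>)) (at_right 0)"
    unfolding average_def set_lebesgue_integral_def
    by (intro always_eventually allI divide_nonneg_nonneg integral_nonneg) (auto simp: indicator_def)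
  show "eventually (\<lambda>r. average M (ball x r) (\<lambda>y. \<bar>w y - w x\<bar>)
      \<le> average M (ball x r) (\<lambda>y. \<bar>v y - v x\<bar>)) (at_right 0)"
    unfolding average_def using assms(2,3)
    by (intro always_eventually allI divide_right_mono set_integral_mono integrable_imp_set_integrable) auto
qed simp

text \<open>
  Maz'ya's truncation argument: the weak type estimates for the truncations of \<open>\<bar>v - a\<bar>\<close> at the
  levels \<open>2\<^sup>k T\<close> can be summed because \<open>q \<ge> p\<close> and their gradients live on disjoint sets.
\<close>

lemma deviation_bound_q: "deviation_bound q"
proof -
  obtain Kw where Kw: "Kw > 0" "\<And>w A x0 r t. \<lbrakk>poincare_pair w A; AE x in M. lebesgue_point w x; 0 < r; 0 < t;
     \<forall>x\<in>ball x0 r. \<bar>average M (ball x r) w\<bar> \<le> t / 4\<rbrakk> \<Longrightarrow>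
     measure M {x \<in> ball x0 r. t \<le> \<bar>w x\<bar>}
       \<le> Kw * vol x0 r * (normalized_energy A x0 r / t powr p) powr (q / p)"
    using weak_type by blast
  \<comment> \<open>One doubling factor comes from \<open>deviation_double_ball\<close>, the other
    from passing from \<open>vol x0 r\<close> to \<open>vol x r\<close>. In \<open>K\<close>, the
    first summand pays for values below \<open>2 * T\<close>, the second for the dyadic layers
    above.\<close>
  define K1 where "K1 = 2 * C * (2 powr Q / c) * (2 powr Q / c)"
  have K1: "K1 > 0" using C_pos c_pos by (simp add: K1_def)
  define K where "K = (8 * K1) powr q + 4 powr q * Kw"
  have q: "q > 0" "q / p \<ge> 1" using p_less_q p_gt_1 by auto
  show ?thesis
    unfolding deviation_bound_def
  proof (intro exI[of _ K] conjI allI impI)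
    show "0 < K" using Kw(1) by (auto simp: K_def intro!: add_nonneg_pos)
    fix x0 r assume r: "0 < (r::real)"
    define a where "a = center x0 r"
    define \<Gamma> where "\<Gamma> = energy x0 r"
    have \<Gamma>: "\<Gamma> > 0" unfolding \<Gamma>_def by (rule energy_pos[OF r])
    have m: "vol x0 r > 0" by (rule ball_pos[OF r])
    \<comment> \<open>The lowest truncation level is the one at which the averages of
      \<open>\<bar>v - a\<bar>\<close> over all \<open>ball x r\<close> are at most
      \<open>T / 4\<close>, as the weak type estimate requires.\<close>
    define T where "T = 4 * K1 * \<Gamma> powr (1 / p)"
    have T: "T > 0" using K1 \<Gamma> by (simp add: T_def)
    have dev: "average M (ball x r) (\<lambda>y. \<bar>v y - a\<bar>) \<le> T / 4" if x: "x \<in> ball x0 r" for x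
    proof -
      have "(LINT y:ball x r|M. \<bar>v y - a\<bar>) \<le> (LINT y:ball x0 (2 * r)|M. \<bar>v y - a\<bar>)"
      proof (rule set_integral_mono_set)
        show "ball x r \<subseteq> ball x0 (2 * r)"
        proof
          fix y assume "y \<in> ball x r"
          then show "y \<in> ball x0 (2 * r)" using x dist_triangle[of x0 y x] by simp
        qed
      qed auto
      also have "\<dots> \<le> 2 * C * (2 powr Q / c) * vol x0 r * \<Gamma> powr (1 / p)"
        using deviation_double_ball[OF r, of x0] by (simp add: a_def \<Gamma>_def)
      also have "vol x0 r \<le> 2 powr Q / c * vol x r"
      proof -
        have "vol x0 r \<le> vol x0 (2 * r)" using r by (intro vol_mono_radius) auto
        also have "\<dots> \<le> 2 powr Q / c * vol x r" using r x by (intro vol_le_shrunk) auto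
        finally show ?thesis .
      qed
      finally have "(LINT y:ball x r|M. \<bar>v y - a\<bar>)
          \<le> 2 * C * (2 powr Q / c) * (2 powr Q / c * vol x r) * \<Gamma> powr (1 / p)"
        using C_pos c_pos by (simp add: mult_left_mono mult_right_mono divide_right_mono)
      then have "(LINT y:ball x r|M. \<bar>v y - a\<bar>) \<le> T / 4 * vol x r"
        by (simp add: T_def K1_def mult_ac)
      then show ?thesis using ball_pos[OF r, of x] by (simp add: average_def field_simps)
    qed
    define t where "t k = T * 2 ^ k" for k :: nat
    have t: "t k > 0" "T \<le> t k" for k using T by (auto simp: t_def)
    define w where "w k x = min (max (\<bar>v x - a\<bar> - t k) 0) (t k)" for k x
    define A where "A k = {x. t k < \<bar>v x - a\<bar> \<and> \<bar>v x - a\<bar> < 2 * t k}" for k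
    define g where "g k = normalized_energy (A k) x0 r" for k
    have pair: "poincare_pair (w k) (A k)" for k
      unfolding w_def A_def by (rule poincare_truncation[OF t(1)])
    have wi: "integrable M (w k)" and Ak: "A k \<in> sets M" for k
      using pair[of k] by (auto simp: poincare_pair_def)
    have level: "{x \<in> ball x0 r. t k \<le> \<bar>w k x\<bar>} = {x \<in> ball x0 r. 2 * t k \<le> \<bar>v x - a\<bar>}" for k
    proof -
      have "t k \<le> \<bar>w k x\<bar> \<longleftrightarrow> 2 * t k \<le> \<bar>v x - a\<bar>" for x
        using t(1)[of k] unfolding w_def by linarith
      then show ?thesis by simp
    qed
    have w_lipschitz: "\<bar>w k y - w k x\<bar> \<le> \<bar>v y - v x\<bar>" for k x y
      unfolding w_def by linarith
    have w_le: "\<bar>w k y\<bar> \<le> \<bar>v y - a\<bar>" for k y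
      using t(1)[of k] unfolding w_def by linarith
    have weak: "measure M {x \<in> ball x0 r. 2 * t k \<le> \<bar>v x - a\<bar>} \<le> Kw * vol x0 r * (g k / t k powr p) powr (q / p)" for k
      unfolding level[symmetric] g_def
    proof (rule Kw(2)[OF pair _ r t(1)])
      show "AE x in M. lebesgue_point (w k) x"
        using AE_lebesgue_point
        by eventually_elim (rule lebesgue_point_lipschitz[OF _ wi w_lipschitz])
      show "\<forall>x\<in>ball x0 r. \<bar>average M (ball x r) (w k)\<bar> \<le> t k / 4"
      proof
        fix x assume x: "x \<in> ball x0 r"
        have "\<bar>average M (ball x r) (w k) - 0\<bar> \<le> average M (ball x r) (\<lambda>y. \<bar>w k y - 0\<bar>)"
          using r wi by (intro abs_average_diff_le ball_pos) auto
        also have "\<dots> \<le> average M (ball x r) (\<lambda>y. \<bar>v y - a\<bar>)"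
          unfolding average_def using wi w_le
          by (intro divide_right_mono set_integral_mono integrable_imp_set_integrable) auto
        also have "\<dots> \<le> t k / 4" using dev[OF x] t(2)[of k] by linarith
        finally show "\<bar>average M (ball x r) (w k)\<bar> \<le> t k / 4" by simp
      qed
    qed
    have disj: "disjoint_family (\<lambda>k. A k \<inter> ball x0 (4 * \<sigma> * r))"
    proof -
      have "A i \<inter> A j = {}" if "i < j" for i j
      proof -
        have "(2::real) ^ Suc i \<le> 2 ^ j" using that by (intro power_increasing) auto
        then have "2 * t i \<le> t j" using T by (simp add: t_def)
        then show ?thesis by (auto simp: A_def)
      qed
      then show ?thesis by (auto simp: disjoint_family_on_def dest!: neq_iff[THEN iffD1])
    qed
    have Nsums: "(\<lambda>k. measure N (A k \<inter> ball x0 (4 * \<sigma> * r))) sums measure N (\<Union>k. A k \<inter> ball x0 (4 * \<sigma> * r))"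
      using Ak disj sets_N by (intro N.finite_measure_UNION) auto
    have "measure N (\<Union>k. A k \<inter> ball x0 (4 * \<sigma> * r)) \<le> measure N (UNIV \<inter> ball x0 (4 * \<sigma> * r))"
      using sets_N by (intro N.finite_measure_mono) auto
    then have "(r powr p / vol x0 r) * measure N (\<Union>k. A k \<inter> ball x0 (4 * \<sigma> * r)) \<le> \<Gamma>"
      using m r by (simp add: \<Gamma>_def normalized_energy_def divide_right_mono)
    moreover have gsums: "g sums ((r powr p / vol x0 r) * measure N (\<Union>k. A k \<inter> ball x0 (4 * \<sigma> * r)))"
    proof -
      have "g = (\<lambda>k. (r powr p / vol x0 r) * measure N (A k \<inter> ball x0 (4 * \<sigma> * r)))"
        by (simp add: fun_eq_iff g_def normalized_energy_def)
      then show ?thesis using sums_mult[OF Nsums, of "r powr p / vol x0 r"] by simp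
    qed
    ultimately have gsum: "summable g" "suminf g \<le> \<Gamma>" by (auto simp: sums_iff)
    have g0: "0 \<le> g k" for k by (simp add: g_def normalized_energy_nonneg)
    have g\<Gamma>: "g k \<le> \<Gamma>" for k
      using sum_le_suminf[OF gsum(1), of "{k}"] g0 gsum(2) by simp
    let ?B = "\<lambda>k. {x \<in> ball x0 r. 2 * t k \<le> \<bar>v x - a\<bar>}"
    have B [measurable]: "?B k \<in> sets M" for k
    proof -
      have "?B k = ball x0 r \<inter> {x \<in> space M. 2 * t k \<le> \<bar>v x - a\<bar>}" by (auto simp: space_UNIV)
      also have "\<dots> \<in> sets M" by measurable
      finally show ?thesis .
    qed
    \<comment> \<open>Splitting \<open>g k powr (q / p)\<close> into
      \<open>g k powr (q / p - 1) * g k\<close> and bounding the first factor by the total energy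
      leaves a term linear in \<open>g k\<close>. The weak type bound scales so that the powers of
      \<open>t k\<close> cancel.\<close>
    have term_le: "(4 * t k) powr q * measure M (?B k) \<le> 4 powr q * Kw * vol x0 r * \<Gamma> powr (q / p - 1) * g k" for k
    proof -
      have "(4 * t k) powr q * measure M (?B k) \<le> (4 * t k) powr q * (Kw * vol x0 r * (g k / t k powr p) powr (q / p))"
        using weak by (intro mult_left_mono) auto
      also have "(g k / t k powr p) powr (q / p) = g k powr (q / p) / t k powr q"
        using g0 p_gt_1 t(1)[of k] by (simp add: powr_divide powr_powr)
      also have "(4 * t k) powr q * (Kw * vol x0 r * (g k powr (q / p) / t k powr q))
          = 4 powr q * Kw * vol x0 r * g k powr (q / p)"
        using t(1)[of k] by (simp add: powr_mult)
      also have "g k powr (q / p) = g k powr (q / p - 1) * g k" using g0[of k] by (auto simp: powr_diff)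
      also have "4 powr q * Kw * vol x0 r * (g k powr (q / p - 1) * g k)
          \<le> 4 powr q * Kw * vol x0 r * (\<Gamma> powr (q / p - 1) * g k)"
        using g0 g\<Gamma> q Kw(1) by (intro mult_left_mono mult_right_mono powr_mono2) auto
      finally show ?thesis by (simp add: mult.assoc)
    qed
    \<comment> \<open>A value is either below \<open>2 * T\<close> or between \<open>2 * t k\<close>
      and \<open>4 * t k\<close> for some \<open>k\<close>.\<close>
    have "(\<integral>\<^sup>+y\<in>ball x0 r. ennreal (\<bar>v y - a\<bar> powr q) \<partial>M)
      \<le> (\<integral>\<^sup>+y. ennreal ((2 * T) powr q) * indicator (ball x0 r) y
          + (\<Sum>k. ennreal ((4 * t k) powr q) * indicator (?B k) y) \<partial>M)"
    proof (rule nn_integral_mono)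
      fix y
      show "ennreal (\<bar>v y - a\<bar> powr q) * indicator (ball x0 r) y
        \<le> ennreal ((2 * T) powr q) * indicator (ball x0 r) y
          + (\<Sum>k. ennreal ((4 * t k) powr q) * indicator (?B k) y)"
      proof (cases "y \<in> ball x0 r")
        case y: True
        show ?thesis
        proof (cases "\<bar>v y - a\<bar> < 2 * T")
          case True
          then have "\<bar>v y - a\<bar> powr q \<le> (2 * T) powr q" using q by (intro powr_mono2) auto
          then show ?thesis using y by (auto intro!: add_increasing2 ennreal_leI)
        next
          case False
          obtain n where "\<bar>v y - a\<bar> / T < 2 ^ n" using real_arch_pow[of 2] by auto
          then have "\<not> 2 * t n \<le> \<bar>v y - a\<bar>" using T by (simp add: t_def field_simps)
          moreover have "2 * t 0 \<le> \<bar>v y - a\<bar>" using False by (simp add: t_def)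
          ultimately obtain k where k: "2 * t k \<le> \<bar>v y - a\<bar>" "\<not> 2 * t (Suc k) \<le> \<bar>v y - a\<bar>"
            using nat_induct[of "\<lambda>k. 2 * t k \<le> \<bar>v y - a\<bar>" n] by blast
          have "\<bar>v y - a\<bar> powr q \<le> (4 * t k) powr q"
            using k(2) q by (intro powr_mono2) (auto simp: t_def)
          then have "ennreal (\<bar>v y - a\<bar> powr q) * indicator (ball x0 r) y
              \<le> ennreal ((4 * t k) powr q) * indicator (?B k) y"
            using k y by (simp add: ennreal_leI)
          also have "\<dots> \<le> (\<Sum>k. ennreal ((4 * t k) powr q) * indicator (?B k) y)"
          proof -
            have "f k \<le> suminf f" for f :: "nat \<Rightarrow> ennreal"
              using sum_le_suminf[of f "{k}"] by simp
            then show ?thesis by (rule meta_spec)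
          qed
          finally show ?thesis by (rule add_increasing[rotated]) simp
        qed
      qed simp
    qed
    also have "\<dots> = (\<integral>\<^sup>+y. ennreal ((2 * T) powr q) * indicator (ball x0 r) y \<partial>M)
        + (\<integral>\<^sup>+y. (\<Sum>k. ennreal ((4 * t k) powr q) * indicator (?B k) y) \<partial>M)"
      using B by (intro nn_integral_add) measurable
    also have "(\<integral>\<^sup>+y. ennreal ((2 * T) powr q) * indicator (ball x0 r) y \<partial>M)
        = ennreal ((2 * T) powr q) * emeasure M (ball x0 r)"
      by (intro nn_integral_cmult_indicator) simp
    also have "(\<integral>\<^sup>+y. (\<Sum>k. ennreal ((4 * t k) powr q) * indicator (?B k) y) \<partial>M)
        = (\<Sum>k. \<integral>\<^sup>+y. ennreal ((4 * t k) powr q) * indicator (?B k) y \<partial>M)"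
      using B by (intro nn_integral_suminf) measurable
    also have "\<dots> = (\<Sum>k. ennreal ((4 * t k) powr q) * emeasure M (?B k))"
      using B by (intro suminf_cong nn_integral_cmult_indicator)
    also have "ennreal ((2 * T) powr q) * emeasure M (ball x0 r) + (\<Sum>k. ennreal ((4 * t k) powr q) * emeasure M (?B k))
        = ennreal ((2 * T) powr q * vol x0 r) + (\<Sum>k. ennreal ((4 * t k) powr q * measure M (?B k)))"
      by (simp only: emeasure_eq_measure ennreal_mult'' measure_nonneg)
    also have "\<dots> \<le> ennreal ((2 * T) powr q * vol x0 r)
        + (\<Sum>k. ennreal (4 powr q * Kw * vol x0 r * \<Gamma> powr (q / p - 1) * g k))"
      using term_le by (intro add_left_mono suminf_le ennreal_leI) auto
    also have "(\<Sum>k. ennreal (4 powr q * Kw * vol x0 r * \<Gamma> powr (q / p - 1) * g k))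
        = ennreal (4 powr q * Kw * vol x0 r * \<Gamma> powr (q / p - 1) * suminf g)"
      using g0 gsum(1) Kw(1) by (subst suminf_ennreal2) (auto intro!: summable_mult simp: suminf_mult)
    also have "\<dots> \<le> ennreal (4 powr q * Kw * vol x0 r * \<Gamma> powr (q / p - 1) * \<Gamma>)"
      using gsum(2) Kw(1) by (intro ennreal_leI mult_left_mono) auto
    also have "4 powr q * Kw * vol x0 r * \<Gamma> powr (q / p - 1) * \<Gamma> = 4 powr q * Kw * vol x0 r * \<Gamma> powr (q / p)"
      using \<Gamma> by (simp add: powr_diff)
    also have "(2 * T) powr q = (8 * K1) powr q * \<Gamma> powr (q / p)"
      using K1 \<Gamma> unfolding T_def by (simp add: powr_mult powr_powr mult.assoc[symmetric])
    also have "ennreal ((8 * K1) powr q * \<Gamma> powr (q / p) * vol x0 r) + ennreal (4 powr q * Kw * vol x0 r * \<Gamma> powr (q / p))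
        = ennreal (K * vol x0 r * \<Gamma> powr (q / p))"
      using Kw(1) by (simp add: K_def ennreal_plus[symmetric] algebra_simps del: ennreal_plus)
    finally show "(\<integral>\<^sup>+y\<in>ball x0 r. ennreal (\<bar>v y - center x0 r\<bar> powr q) \<partial>M)
        \<le> ennreal (K * vol x0 r * energy x0 r powr (q / p))"
      by (simp add: add_left_mono a_def \<Gamma>_def)
  qed
qed

text \<open>Lowering the exponent by a pointwise inequality: below
  \<open>\<Gamma> powr (1 / p)\<close> the power \<open>h\<close> is at most
  \<open>\<Gamma> powr (h / p)\<close>, above it the power \<open>q\<close> dominates after scaling.
  Both terms integrate to the same power of the energy.\<close>

lemma deviation_bound_le_q:
  assumes "0 < h" "h \<le> q"
  shows "deviation_bound h"
proof -
  obtain K where K: "K > 0" "\<And>z r. 0 < r \<Longrightarrow>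
     (\<integral>\<^sup>+y\<in>ball z r. ennreal (\<bar>v y - center z r\<bar> powr q) \<partial>M) \<le> ennreal (K * vol z r * energy z r powr (q / p))"
    using deviation_bound_q by (auto simp: deviation_bound_def)
  show ?thesis
    unfolding deviation_bound_def
  proof (intro exI[of _ "1 + K"] conjI allI impI)
    show "0 < 1 + K" using K by simp
    fix z r assume r: "0 < (r::real)"
    define a where "a = center z r"
    define \<Gamma> where "\<Gamma> = energy z r"
    have \<Gamma>: "\<Gamma> > 0" unfolding \<Gamma>_def by (rule energy_pos[OF r])
    have pw: "s powr h \<le> \<Gamma> powr (h / p) + \<Gamma> powr (h / p - q / p) * s powr q" if "0 \<le> s" for s
    proof (cases "s \<le> \<Gamma> powr (1 / p)")
      case True
      then have "s powr h \<le> (\<Gamma> powr (1 / p)) powr h" using that assms by (intro powr_mono2) auto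
      also have "\<dots> = \<Gamma> powr (h / p)" by (simp add: powr_powr)
      finally show ?thesis by (rule add_increasing2[rotated]) simp
    next
      case False
      then have s: "s > 0" using powr_ge_zero[of \<Gamma> "1 / p"] by linarith
      have "(\<Gamma> powr (1 / p)) powr (q - h) \<le> s powr (q - h)"
        using False assms by (intro powr_mono2) auto
      then have "\<Gamma> powr (h / p - q / p) * (\<Gamma> powr (1 / p)) powr (q - h) * s powr h
          \<le> \<Gamma> powr (h / p - q / p) * s powr (q - h) * s powr h"
        by (intro mult_right_mono mult_left_mono) auto
      moreover have "\<Gamma> powr (h / p - q / p) * (\<Gamma> powr (1 / p)) powr (q - h) = 1"
        using \<Gamma> by (simp add: powr_powr powr_add[symmetric] diff_divide_distrib)
      moreover have "s powr (q - h) * s powr h = s powr q"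
        using s by (simp add: powr_add[symmetric])
      ultimately have "s powr h \<le> \<Gamma> powr (h / p - q / p) * s powr q" by (simp add: mult.assoc)
      then show ?thesis by (rule add_increasing[rotated]) simp
    qed
    have "(\<integral>\<^sup>+y\<in>ball z r. ennreal (\<bar>v y - a\<bar> powr h) \<partial>M)
      \<le> (\<integral>\<^sup>+y. ennreal (\<Gamma> powr (h / p)) * indicator (ball z r) y
        + ennreal (\<Gamma> powr (h / p - q / p)) * (ennreal (\<bar>v y - a\<bar> powr q) * indicator (ball z r) y) \<partial>M)"
    proof (rule nn_integral_mono)
      fix y
      show "ennreal (\<bar>v y - a\<bar> powr h) * indicator (ball z r) y
        \<le> ennreal (\<Gamma> powr (h / p)) * indicator (ball z r) y
        + ennreal (\<Gamma> powr (h / p - q / p)) * (ennreal (\<bar>v y - a\<bar> powr q) * indicator (ball z r) y)"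
        using pw[of "\<bar>v y - a\<bar>"]
        by (auto simp: indicator_def ennreal_mult[symmetric] ennreal_plus[symmetric] simp del: ennreal_plus intro!: ennreal_leI)
    qed
    also have "\<dots> = ennreal (\<Gamma> powr (h / p)) * emeasure M (ball z r)
        + ennreal (\<Gamma> powr (h / p - q / p)) * (\<integral>\<^sup>+y\<in>ball z r. ennreal (\<bar>v y - a\<bar> powr q) \<partial>M)"
      by (subst nn_integral_add) (auto simp: nn_integral_cmult)
    also have "\<dots> \<le> ennreal (\<Gamma> powr (h / p)) * ennreal (vol z r)
        + ennreal (\<Gamma> powr (h / p - q / p)) * ennreal (K * vol z r * \<Gamma> powr (q / p))"
      unfolding a_def \<Gamma>_def using K(2)[OF r, of z] by (intro add_mono mult_left_mono) (auto simp: emeasure_eq_measure)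
    also have "\<dots> = ennreal (\<Gamma> powr (h / p) * vol z r + K * vol z r * (\<Gamma> powr (h / p - q / p) * \<Gamma> powr (q / p)))"
      using K by (simp add: ennreal_mult[symmetric] ennreal_plus[symmetric] mult_ac del: ennreal_plus)
    also have "\<Gamma> powr (h / p - q / p) * \<Gamma> powr (q / p) = \<Gamma> powr (h / p)"
      using \<Gamma> by (simp add: powr_add[symmetric])
    finally show "(\<integral>\<^sup>+y\<in>ball z r. ennreal (\<bar>v y - center z r\<bar> powr h) \<partial>M)
      \<le> ennreal ((1 + K) * vol z r * energy z r powr (h / p))"
      by (simp add: a_def \<Gamma>_def algebra_simps)
  qed
qed

text \<open>The pointwise bound is used with \<open>s = p\<close>, whose integral is of order
  \<open>d k powr p\<close>. On each dyadic block the measure \<open>dr / r\<close> is bounded, so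
  the inner integral is at most a constant times the sum of
  \<open>F k x powr (1 / (p - 1))\<close>.\<close>

lemma oscillation_integral_finite:
  assumes h: "0 < h" "h \<le> q" and \<delta>: "0 < \<delta>"
  shows "(\<integral>\<^sup>+x. epowr
            (\<integral>\<^sup>+r\<in>{0<..<\<delta>}.
               epowr (nn_average M (ball x r) (\<lambda>y. ennreal (\<bar>v y - v x\<bar> powr h)))
                     (p / (h * (p - 1))) * ennreal (1 / r) \<partial>lborel)
            (p - 1) \<partial>M) < \<infinity>"
proof -
  let ?I = "\<lambda>x. (\<integral>\<^sup>+r\<in>{0<..<\<delta>}.
               epowr (nn_average M (ball x r) (\<lambda>y. ennreal (\<bar>v y - v x\<bar> powr h)))
                     (p / (h * (p - 1))) * ennreal (1 / r) \<partial>lborel)"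
  \<comment> \<open>The exponents fit as \<open>h / p * e = \<beta>\<close>, so \<open>h\<close>
    drops out of the power of \<open>F k x\<close>, and the outer power \<open>p - 1\<close> undoes
    \<beta>.\<close>
  define e where "e = p / (h * (p - 1))"
  define \<beta> where "\<beta> = 1 / (p - 1)"
  have e: "e > 0" and \<beta>: "\<beta> > 0" using p_gt_1 h by (auto simp: e_def \<beta>_def)
  define d where "d k = \<delta> / 2 ^ k" for k :: nat
  have d: "d k > 0" "d (Suc k) = d k / 2" for k using \<delta> by (auto simp: d_def)
  obtain K where K: "K > 0" "\<forall>r>0. \<exists>F. F \<in> borel_measurable M \<and> (\<forall>x. 0 \<le> F x) \<and>
    (\<forall>x r'. r / 2 \<le> r' \<longrightarrow> r' \<le> r \<longrightarrow>
      (\<integral>\<^sup>+y\<in>ball x r'. ennreal (\<bar>v y - v x\<bar> powr h) \<partial>M) \<le> ennreal (K * vol x r' * F x powr (h / p))) \<and>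
    (\<integral>\<^sup>+x. ennreal (F x) \<partial>M) \<le> ennreal (K * r powr p)"
    using pointwise_deviation_cover[OF deviation_bound_le_q[OF h] deviation_bound_le_q[OF _ less_imp_le[OF p_less_q]] h(1)]
      p_gt_1 by auto
  define P where "P k F \<longleftrightarrow> F \<in> borel_measurable M \<and> (\<forall>x. 0 \<le> F x) \<and>
    (\<forall>x r'. d k / 2 \<le> r' \<longrightarrow> r' \<le> d k \<longrightarrow>
      (\<integral>\<^sup>+y\<in>ball x r'. ennreal (\<bar>v y - v x\<bar> powr h) \<partial>M) \<le> ennreal (K * vol x r' * F x powr (h / p))) \<and>
    (\<integral>\<^sup>+x. ennreal (F x) \<partial>M) \<le> ennreal (K * d k powr p)" for k F
  have "\<exists>F. P k F" for k unfolding P_def using K(2) d(1) by blast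
  then obtain F where "\<And>k. P k (F k)" by metis
  then have F: "\<And>k. F k \<in> borel_measurable M" "\<And>k x. 0 \<le> F k x"
    "\<And>k x r'. d k / 2 \<le> r' \<Longrightarrow> r' \<le> d k \<Longrightarrow>
      (\<integral>\<^sup>+y\<in>ball x r'. ennreal (\<bar>v y - v x\<bar> powr h) \<partial>M) \<le> ennreal (K * vol x r' * F k x powr (h / p))"
    "\<And>k. (\<integral>\<^sup>+x. ennreal (F k x) \<partial>M) \<le> ennreal (K * d k powr p)"
    by (auto simp: P_def)
  note F(1)[measurable]
  \<comment> \<open>\<open>1 / r \<le> 2 / d k\<close> on the block; the block's length
    \<open>d k / 2\<close> cancels this factor after integration.\<close>
  have piece: "epowr (nn_average M (ball x r) (\<lambda>y. ennreal (\<bar>v y - v x\<bar> powr h))) e * ennreal (1 / r)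
      \<le> ennreal (K powr e * F k x powr \<beta> * (2 / d k))" if r: "d k / 2 \<le> r" "r \<le> d k" for x r k
  proof -
    have r0: "r > 0" using r d(1)[of k] by linarith
    have m: "vol x r > 0" by (rule ball_pos[OF r0])
    have "nn_average M (ball x r) (\<lambda>y. ennreal (\<bar>v y - v x\<bar> powr h))
        \<le> ennreal (K * vol x r * F k x powr (h / p)) / emeasure M (ball x r)"
      unfolding nn_average_def by (rule divide_right_mono_ennreal[OF F(3)[OF r]])
    also have "\<dots> = ennreal (K * F k x powr (h / p))"
      using m K(1) by (simp add: emeasure_eq_measure divide_ennreal)
    finally have "epowr (nn_average M (ball x r) (\<lambda>y. ennreal (\<bar>v y - v x\<bar> powr h))) e
        \<le> epowr (ennreal (K * F k x powr (h / p))) e"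
      using e by (intro epowr_mono) auto
    also have "\<dots> = ennreal ((K * F k x powr (h / p)) powr e)" using K(1) by (simp add: epowr_ennreal)
    also have "(K * F k x powr (h / p)) powr e = K powr e * F k x powr \<beta>"
      using h p_gt_1 by (simp add: powr_mult powr_powr e_def \<beta>_def)
    finally have "epowr (nn_average M (ball x r) (\<lambda>y. ennreal (\<bar>v y - v x\<bar> powr h))) e * ennreal (1 / r)
        \<le> ennreal (K powr e * F k x powr \<beta>) * ennreal (2 / d k)"
      using r r0 d(1)[of k] by (intro mult_mono ennreal_leI) (auto simp: field_simps)
    also have "\<dots> = ennreal (K powr e * F k x powr \<beta> * (2 / d k))"
      using d(1)[of k] by (intro ennreal_mult[symmetric]) auto
    finally show ?thesis .
  qed
  have inner: "?I x \<le> (\<Sum>k. ennreal (K powr e * F k x powr \<beta>))" for x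
  proof -
    have "?I x \<le> (\<integral>\<^sup>+r. (\<Sum>k. ennreal (K powr e * F k x powr \<beta> * (2 / d k)) * indicator {d k / 2..d k} r) \<partial>lborel)"
    proof (rule nn_integral_mono)
      fix r :: real
      show "epowr (nn_average M (ball x r) (\<lambda>y. ennreal (\<bar>v y - v x\<bar> powr h)))
              (p / (h * (p - 1))) * ennreal (1 / r) * indicator {0<..<\<delta>} r
        \<le> (\<Sum>k. ennreal (K powr e * F k x powr \<beta> * (2 / d k)) * indicator {d k / 2..d k} r)"
      proof (cases "r \<in> {0<..<\<delta>}")
        case True
        then have "0 < r / \<delta>" using \<delta> by simp
        then obtain n :: nat where "(1 / 2) ^ n < r / \<delta>" using real_arch_pow_inv[of "r / \<delta>" "1 / 2"] by auto
        then have "\<not> r \<le> d n" using \<delta> by (simp add: d_def field_simps power_divide)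
        moreover have "r \<le> d 0" using True by (simp add: d_def)
        ultimately obtain k where k: "r \<le> d k" "\<not> r \<le> d (Suc k)"
          using nat_induct[of "\<lambda>k. r \<le> d k" n] by blast
        then have r: "d k / 2 \<le> r" "r \<le> d k" using d(2) by auto
        have "f k \<le> suminf f" for f :: "nat \<Rightarrow> ennreal"
          using sum_le_suminf[of f "{k}"] by simp
        from this[of "\<lambda>k. ennreal (K powr e * F k x powr \<beta> * (2 / d k)) * indicator {d k / 2..d k} r"]
        show ?thesis using piece[OF r, of x] r True by (simp add: e_def)
      qed simp
    qed
    also have "\<dots> = (\<Sum>k. \<integral>\<^sup>+r. ennreal (K powr e * F k x powr \<beta> * (2 / d k)) * indicator {d k / 2..d k} r \<partial>lborel)"
      by (rule nn_integral_suminf) measurable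
    also have "\<dots> = (\<Sum>k. ennreal (K powr e * F k x powr \<beta>))"
    proof (rule suminf_cong)
      fix k
      have "(\<integral>\<^sup>+r. ennreal (K powr e * F k x powr \<beta> * (2 / d k)) * indicator {d k / 2..d k} r \<partial>lborel)
          = ennreal (K powr e * F k x powr \<beta> * (2 / d k)) * emeasure lborel {d k / 2..d k}"
        by (rule nn_integral_cmult_indicator) simp
      also have "\<dots> = ennreal (K powr e * F k x powr \<beta> * (2 / d k)) * ennreal (d k / 2)"
        using d(1)[of k] by simp
      also have "\<dots> = ennreal (K powr e * F k x powr \<beta> * (2 / d k) * (d k / 2))"
        using d(1)[of k] by (intro ennreal_mult[symmetric]) auto
      finally show "(\<integral>\<^sup>+r. ennreal (K powr e * F k x powr \<beta> * (2 / d k)) * indicator {d k / 2..d k} r \<partial>lborel)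
          = ennreal (K powr e * F k x powr \<beta>)" using d(1)[of k] by simp
    qed
    finally show ?thesis .
  qed
  define \<theta> :: real where "\<theta> = (1 / 2) powr \<beta>"
  have \<theta>: "0 < \<theta>" "\<theta> < 1" using \<beta> powr_less_mono2[of \<beta> "1 / 2" 1] by (auto simp: \<theta>_def)
  define D where "D = (K powr e / (1 - \<theta>)) powr (p - 1)"
  have D: "D > 0" using K(1) \<theta> by (simp add: D_def)
  \<comment> \<open>The weights \<open>2 ^ k\<close> give
    \<open>F k x \<le> (1 / 2) ^ k * W x\<close>, so the powers with exponent \<beta> form a
    geometric series of ratio \<theta>. \<open>D\<close> is the constant of that series after the
    outer power.\<close>
  define W where "W x = (\<Sum>k. ennreal (2 ^ k * F k x))" for x
  have outer: "epowr (?I x) (p - 1) \<le> ennreal D * W x" for x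
  proof (cases "W x = \<infinity>")
    case True
    then show ?thesis using D by (simp add: ennreal_mult_eq_top_iff ennreal_mult_top)
  next
    case False
    then obtain w where w: "0 \<le> w" "W x = ennreal w" by (cases "W x") auto
    have Fw: "F k x \<le> (1 / 2) ^ k * w" for k
    proof -
      have "f k \<le> suminf f" for f :: "nat \<Rightarrow> ennreal"
        using sum_le_suminf[of f "{k}"] by simp
      from this[of "\<lambda>k. ennreal (2 ^ k * F k x)"] have "ennreal (2 ^ k * F k x) \<le> ennreal w"
        using w by (simp add: W_def)
      then show ?thesis using w by (simp add: field_simps power_divide)
    qed
    have "?I x \<le> (\<Sum>k. ennreal (K powr e * F k x powr \<beta>))" by (rule inner)
    also have "\<dots> \<le> (\<Sum>k. ennreal (K powr e * w powr \<beta> * \<theta> ^ k))"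
    proof (intro suminf_le ennreal_leI allI)
      fix k
      have "F k x powr \<beta> \<le> ((1 / 2) ^ k * w) powr \<beta>" using F(2) Fw \<beta> by (intro powr_mono2) auto
      also have "\<dots> = w powr \<beta> * \<theta> ^ k"
        using w by (simp add: powr_mult \<theta>_def powr_realpow[symmetric] powr_powr mult.commute)
      finally show "K powr e * F k x powr \<beta> \<le> K powr e * w powr \<beta> * \<theta> ^ k"
        by (simp add: mult_left_mono mult.assoc)
    qed auto
    also have "\<dots> = ennreal (\<Sum>k. K powr e * w powr \<beta> * \<theta> ^ k)"
      using \<theta> by (intro suminf_ennreal2 summable_mult summable_geometric) auto
    also have "(\<Sum>k. K powr e * w powr \<beta> * \<theta> ^ k) = K powr e / (1 - \<theta>) * w powr \<beta>"
      using \<theta> by (subst suminf_mult) (auto simp: suminf_geometric summable_geometric)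
    finally have "epowr (?I x) (p - 1) \<le> epowr (ennreal (K powr e / (1 - \<theta>) * w powr \<beta>)) (p - 1)"
      using p_gt_1 by (intro epowr_mono) auto
    also have "\<dots> = ennreal ((K powr e / (1 - \<theta>) * w powr \<beta>) powr (p - 1))"
      using \<theta> by (intro epowr_ennreal) auto
    also have "(K powr e / (1 - \<theta>) * w powr \<beta>) powr (p - 1) = D * w"
      using \<theta> w p_gt_1 unfolding D_def by (subst powr_mult) (auto simp: powr_powr \<beta>_def)
    finally show ?thesis using w D by (simp add: ennreal_mult)
  qed
  have "(\<integral>\<^sup>+x. epowr (?I x) (p - 1) \<partial>M) \<le> (\<integral>\<^sup>+x. ennreal D * W x \<partial>M)"
    by (intro nn_integral_mono outer)
  also have "\<dots> = ennreal D * (\<Sum>k. \<integral>\<^sup>+x. ennreal (2 ^ k * F k x) \<partial>M)"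
    unfolding W_def by (subst nn_integral_cmult) (auto simp: nn_integral_suminf)
  also have "\<dots> \<le> ennreal D * (\<Sum>k. ennreal (K * \<delta> powr p * (2 powr (1 - p)) ^ k))"
  proof (intro mult_left_mono suminf_le allI)
    fix k
    have "(\<integral>\<^sup>+x. ennreal (2 ^ k * F k x) \<partial>M) = ennreal (2 ^ k) * (\<integral>\<^sup>+x. ennreal (F k x) \<partial>M)"
      using F(2) by (subst nn_integral_cmult[symmetric]) (auto simp: ennreal_mult)
    also have "\<dots> \<le> ennreal (2 ^ k) * ennreal (K * d k powr p)" by (intro mult_left_mono F(4)) simp
    also have "\<dots> = ennreal (2 ^ k * (K * d k powr p))" using K(1) by (intro ennreal_mult[symmetric]) auto
    also have "2 ^ k * (K * d k powr p) = K * \<delta> powr p * (2 powr (1 - p)) ^ k"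
      using \<delta> by (simp add: d_def powr_divide powr_diff power_divide powr_realpow[symmetric] powr_powr mult.commute)
    finally show "(\<integral>\<^sup>+x. ennreal (2 ^ k * F k x) \<partial>M) \<le> ennreal (K * \<delta> powr p * (2 powr (1 - p)) ^ k)" .
  qed auto
  also have "(\<Sum>k. ennreal (K * \<delta> powr p * (2 powr (1 - p)) ^ k)) = ennreal (\<Sum>k. K * \<delta> powr p * (2 powr (1 - p)) ^ k)"
  proof -
    have "2 powr (1 - p) < (1::real)" using p_gt_1 powr_less_cancel_iff[of 2 "1 - p" 0] by simp
    then show ?thesis using K(1) by (intro suminf_ennreal2 summable_mult summable_geometric) auto
  qed
  also have "ennreal D * \<dots> < \<infinity>" by (simp add: ennreal_mult_less_top)
  finally show ?thesis .
qed

end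

section \<open>From Newton--Sobolev functions to the abstract setting\<close>

lemma upper_gradient_add_one:
  fixes u :: "'a::metric_space \<Rightarrow> real"
  assumes "upper_gradient u g"
  shows "upper_gradient u (\<lambda>x. g x + 1)"
  unfolding upper_gradient_def
proof (intro conjI allI impI)
  show "(\<lambda>x. g x + 1) \<in> borel_measurable borel" using upper_gradient_borel[OF assms] by simp
  fix \<gamma> :: "real \<Rightarrow> 'a" and l assume "arc_length_curve \<gamma> l"
  then have "ennreal \<bar>u (\<gamma> 0) - u (\<gamma> l)\<bar> \<le> curve_integral \<gamma> l g"
    using assms unfolding upper_gradient_def by blast
  also have "\<dots> \<le> curve_integral \<gamma> l (\<lambda>x. g x + 1)"
    unfolding curve_integral_def by (intro nn_integral_mono mult_right_mono) auto
  finally show "ennreal \<bar>u (\<gamma> 0) - u (\<gamma> l)\<bar> \<le> curve_integral \<gamma> l (\<lambda>x. g x + 1)" .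
qed

lemma epowr_add_one_le:
  assumes "0 < p"
  shows "epowr (x + 1) p \<le> ennreal (2 powr p) * (epowr x p + 1)"
proof (cases x)
  case (real r)
  then have "epowr (x + 1) p = ennreal ((r + 1) powr p)"
    by (simp add: epowr_ennreal flip: ennreal_plus ennreal_1)
  also have "\<dots> \<le> ennreal (2 powr p * (r powr p + 1))"
    using powr_add_le[of r 1 p] real assms by (intro ennreal_leI) simp
  finally show ?thesis using real by (simp add: epowr_ennreal ennreal_mult)
next
  case top
  then show ?thesis by (simp add: epowr_def ennreal_mult_eq_top_iff ennreal_mult_top)
qed

lemma one_le_epowr_add_one:
  assumes "0 < p"
  shows "1 \<le> epowr (x + 1) p"
  using epowr_mono[of 1 "x + 1" p] assms epowr_ennreal[of 1 p] by simp

lemma limsup_averages_lebesgue_point: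
  assumes "((\<lambda>r. average M (ball x r) v) \<longlongrightarrow> v x) (at_right 0)"
  shows "limsup_averages M v x = ereal (v x)"
  unfolding limsup_averages_def using assms by (intro lim_imp_Limsup) (auto intro!: tendsto_ereal)

lemma newton_space_member:
  assumes "U \<in> newton_space M p" "v \<in> U"
  shows "v \<in> newton_functions M p"
  using assms by (auto simp: newton_space_def newton_rel_def quotient_def)

text \<open>The conjugate exponent \<open>Q' * p / (Q' - p)\<close> tends to infinity as
  \<open>Q'\<close> decreases to \<open>p\<close>, so every \<open>h\<close> is reached by some
  \<open>Q' > p\<close>.\<close>

lemma exponent_enlargement:
  fixes p Q h :: real
  assumes "1 < p" "(p < Q \<and> 0 < h \<and> h \<le> Q * p / (Q - p)) \<or> (p = Q \<and> 0 < h) \<or> (p > Q \<and> 0 < h)"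
  obtains Q' where "Q \<le> Q'" "p < Q'" "h \<le> Q' * p / (Q' - p)"
proof (cases "p < Q")
  case True
  then show thesis using assms by (intro that[of Q]) auto
next
  case False
  then have h: "0 < h" "Q \<le> p" using assms by auto
  \<comment> \<open>For this choice the conjugate exponent equals \<open>h + p\<close>.\<close>
  define Q' where "Q' = p + p * p / h"
  have d: "p * p / h > 0" using assms(1) h by simp
  have "h * (Q' - p) \<le> Q' * p"
    using d h assms(1) by (simp add: Q'_def algebra_simps)
  moreover have "0 < Q' - p" using d by (simp add: Q'_def)
  ultimately have "h \<le> Q' * p / (Q' - p)" by (simp only: pos_le_divide_eq)
  then show thesis using \<open>0 < Q' - p\<close> h by (intro that[of Q']) auto
qed

text \<open>
  Gradients must be Borel but the level sets of \<open>w\<close> need not be, so \<open>A\<close> is replaced by a Borel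
  superset \<open>A'\<close> of the same measure.
\<close>

lemma poincare_setting_truncation:
  fixes M :: "'a::metric_space measure"
  assumes "poincare_setting M N c Q p \<sigma> C"
    and mms: "metric_measure_space M"
    and N: "N = density M (\<lambda>x. epowr (g x) p)"
    and g: "g \<in> borel_measurable borel" and fin: "(\<integral>\<^sup>+x. epowr (g x) p \<partial>M) < \<infinity>"
    and C: "C = 2 * C0"
    and PI: "\<And>x r u g. \<lbrakk>0 < r; integrable M u; weak_upper_gradient M p u g\<rbrakk> \<Longrightarrow>
        nn_average M (ball x r) (\<lambda>y. ennreal \<bar>u y - average M (ball x r) u\<bar>)
          \<le> ennreal (C0 * diameter (ball x r)) *
            epowr (nn_average M (ball x (\<sigma> * r)) (\<lambda>y. epowr (g y) p)) (1 / p)"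
    and w: "integrable M w" and A: "A \<in> sets M"
    and wug: "\<And>A'. A' \<in> sets borel \<Longrightarrow> A \<subseteq> A' \<Longrightarrow> weak_upper_gradient M p w (\<lambda>x. g x * indicator A' x)"
  shows "poincare_setting.poincare_pair M N p \<sigma> C w A"
proof -
  interpret poincare_setting M N c Q p \<sigma> C by fact
  have gM [measurable]: "g \<in> borel_measurable M"
    using g borel_sets space_UNIV by (auto simp: measurable_def)
  obtain A' where A': "A' \<in> sets borel" "A \<subseteq> A'" "emeasure M A' = emeasure M A"
    using mms A unfolding metric_measure_space_def by blast
  have A'M [measurable]: "A' \<in> sets M" using A' borel_sets by blast
  have "emeasure M (A' - A) = 0"
    using A A' by (subst emeasure_Diff) (auto simp: emeasure_eq_measure)
  then have "A' - A \<in> null_sets M" using A by auto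
  then have ae: "AE x in M. x \<in> A' \<longleftrightarrow> x \<in> A"
    using A' by (auto dest!: AE_not_in elim!: eventually_mono)
  have emN: "emeasure N E = (\<integral>\<^sup>+x. epowr (g x) p * indicator E x \<partial>M)" if "E \<in> sets M" for E
    unfolding N using that by (intro emeasure_density) measurable
  \<comment> \<open>Cutting off by the Borel set \<open>A'\<close> or by \<open>A\<close> gives the
    same integrals, so the estimate can be stated with \<open>A\<close>.\<close>
  have nu: "(\<integral>\<^sup>+y\<in>ball x s. epowr (g y * indicator A' y) p \<partial>M) = ennreal (measure N (A \<inter> ball x s))" for x s
  proof -
    have "(\<integral>\<^sup>+y\<in>ball x s. epowr (g y * indicator A' y) p \<partial>M) = (\<integral>\<^sup>+y. epowr (g y) p * indicator (A \<inter> ball x s) y \<partial>M)"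
      using ae by (intro nn_integral_cong_AE) (erule eventually_mono, auto simp: indicator_def epowr_def)
    also have "\<dots> = emeasure N (A \<inter> ball x s)" using A by (subst emN) auto
    finally show ?thesis by (simp add: N.emeasure_eq_measure)
  qed
  show ?thesis
    unfolding poincare_pair_def
  proof (intro conjI allI impI w A)
    fix x and r :: real assume r: "0 < r"
    have sr: "0 < \<sigma> * r" using r \<sigma>_ge_1 by simp
    have m: "vol x r > 0" "vol x (\<sigma> * r) > 0" using r sr by (auto intro: ball_pos)
    have "nn_average M (ball x (\<sigma> * r)) (\<lambda>y. epowr (g y * indicator A' y) p) = ennreal (dens A x (\<sigma> * r))"
      unfolding nn_average_def dens_def nu using m by (simp add: emeasure_eq_measure divide_ennreal)
    then have R: "epowr (nn_average M (ball x (\<sigma> * r)) (\<lambda>y. epowr (g y * indicator A' y) p)) (1 / p)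
        = ennreal (dens A x (\<sigma> * r) powr (1 / p))" by (simp add: epowr_ennreal dens_nonneg)
    let ?L = "LINT y:ball x r|M. \<bar>w y - average M (ball x r) w\<bar>"
    have L0: "0 \<le> ?L"
      unfolding set_lebesgue_integral_def by (intro Bochner_Integration.integral_nonneg) (auto simp: indicator_def)
    have "nn_average M (ball x r) (\<lambda>y. ennreal \<bar>w y - average M (ball x r) w\<bar>) = ennreal ?L / emeasure M (ball x r)"
      unfolding nn_average_def using w by (subst nn_integral_set_eq_integral) auto
    also have "\<dots> = ennreal (?L / vol x r)"
      using m L0 by (simp add: emeasure_eq_measure divide_ennreal)
    finally have "ennreal (?L / vol x r) \<le> ennreal (C0 * diameter (ball x r)) * ennreal (dens A x (\<sigma> * r) powr (1 / p))"
      using PI[OF r w wug[OF A'(1,2)], of x] by (simp add: R)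
    \<comment> \<open>Bounding the diameter by \<open>2 * r\<close> is the origin of
      \<open>C = 2 * C0\<close>.\<close>
    also have "\<dots> \<le> ennreal (C0 * (2 * r)) * ennreal (dens A x (\<sigma> * r) powr (1 / p))"
    proof (intro mult_right_mono ennreal_leI mult_left_mono)
      show "diameter (ball x r) \<le> 2 * r"
      proof -
        have "dist y z \<le> 2 * r" if "dist x y < r" "dist x z < r" for y z
          using that dist_triangle3[of y z x] by simp
        then show ?thesis using r by (auto simp: diameter_def intro!: cSUP_least)
      qed
    qed (use C C_pos in auto)
    also have "\<dots> = ennreal (C * r * dens A x (\<sigma> * r) powr (1 / p))"
      using C C_pos r by (simp add: ennreal_mult[symmetric])
    finally have "?L / vol x r \<le> C * r * dens A x (\<sigma> * r) powr (1 / p)"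
      using C_pos r by (subst (asm) ennreal_le_iff) auto
    then show "?L \<le> C * r * vol x r * dens A x (\<sigma> * r) powr (1 / p)"
      using m by (simp add: field_simps)
  qed
qed

lemma upper_gradient_imp_weak:
  assumes "upper_gradient u g" "0 < p"
  shows "weak_upper_gradient M p u g"
  unfolding weak_upper_gradient_def almost_every_curve_def
proof (intro conjI bexI[of _ "\<lambda>_. 0"] allI impI)
  show "(\<integral>\<^sup>+x. epowr 0 p \<partial>M) < \<infinity>" by (simp add: epowr_def)
qed (use assms in \<open>auto simp: upper_gradient_def\<close>)

theorem mainTheorem3:
  fixes M :: "'a::complete_space measure"
    and p Q \<delta> h :: real
    and U :: "('a \<Rightarrow> real) set"
    and v :: "'a \<Rightarrow> real"
    and u :: "'a \<Rightarrow> ereal"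
  assumes "metric_measure_space M"
    and "doubling_measure M"
    and "1 < p"
    and "supports_poincare M p"
    and "0 < Q"
    and "relative_lower_volume_decay M Q"
    and "0 < \<delta>"
    and "U \<in> newton_space M p"
    and "v \<in> U"
    and "\<And>x. u x = limsup_averages M v x"
    and "(p < Q \<and> 0 < h \<and> h \<le> Q * p / (Q - p)) \<or> (p = Q \<and> 0 < h) \<or> (p > Q \<and> 0 < h)"
    and "emeasure M UNIV < \<infinity>"
  shows "(\<integral>\<^sup>+x. epowr
            (\<integral>\<^sup>+r\<in>{0<..<\<delta>}.
               epowr (nn_average M (ball x r) (\<lambda>y. epowr (e2ennreal \<bar>u y - u x\<bar>) h))
                     (p / (h * (p - 1))) * ennreal (1 / r) \<partial>lborel)
            (p - 1) \<partial>M) < \<infinity>"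
proof -
  have space_M: "space M = UNIV" and borel: "sets borel \<subseteq> sets M"
    and balls: "\<And>x r. 0 < r \<Longrightarrow> 0 < emeasure M (ball x r)"
    using assms(1) by (auto simp: metric_measure_space_def)
  interpret M: finite_measure M using assms(12) by (intro finite_measureI) (simp add: space_M)
  have h: "0 < h" using assms(11) by auto
  obtain Q' where Q': "Q \<le> Q'" "p < Q'" "h \<le> Q' * p / (Q' - p)"
    using exponent_enlargement[OF assms(3,11)] by blast
  have "v \<in> newton_functions M p" by (rule newton_space_member[OF assms(8,9)])
  then obtain g0 where v [measurable]: "v \<in> borel_measurable M"
    and vp: "(\<integral>\<^sup>+x. ennreal (\<bar>v x\<bar> powr p) \<partial>M) < \<infinity>"
    and g0: "upper_gradient v g0" "(\<integral>\<^sup>+x. epowr (g0 x) p \<partial>M) < \<infinity>"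
    by (auto simp: newton_functions_def)
  \<comment> \<open>The constant 1 has finite p-th power integral because the total measure is
    finite.\<close>
  define g where "g x = g0 x + 1" for x
  have g: "upper_gradient v g" unfolding g_def[abs_def] by (rule upper_gradient_add_one[OF g0(1)])
  have to_M: "f \<in> borel_measurable M" if "f \<in> borel_measurable borel" for f :: "'a \<Rightarrow> ennreal"
    using that borel space_M by (auto simp: measurable_def)
  have g0M [measurable]: "g0 \<in> borel_measurable M" and gM [measurable]: "g \<in> borel_measurable M"
    using g0(1) g by (auto intro: to_M upper_gradient_borel)
  have gfin: "(\<integral>\<^sup>+x. epowr (g x) p \<partial>M) < \<infinity>"
  proof -
    have "(\<integral>\<^sup>+x. epowr (g x) p \<partial>M) \<le> (\<integral>\<^sup>+x. ennreal (2 powr p) * (epowr (g0 x) p + 1) \<partial>M)"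
      unfolding g_def using assms(3) by (intro nn_integral_mono epowr_add_one_le) simp
    also have "\<dots> = ennreal (2 powr p) * ((\<integral>\<^sup>+x. epowr (g0 x) p \<partial>M) + emeasure M (space M))"
      by (subst nn_integral_cmult) (auto simp: nn_integral_add)
    also have "\<dots> < \<infinity>" using g0(2) assms(12) by (simp add: ennreal_mult_less_top space_M)
    finally show ?thesis .
  qed
  obtain c where c: "0 < c" "\<And>x y r R. \<lbrakk>y \<in> ball x R; 0 < r; r \<le> R\<rbrakk> \<Longrightarrow>
      c * (r / R) powr Q \<le> measure M (ball y r) / measure M (ball x R)"
    using assms(6) by (auto simp: relative_lower_volume_decay_def)
  obtain C0 \<sigma> where C0: "0 < C0" "1 \<le> \<sigma>" and PI: "\<And>x r u g. \<lbrakk>0 < r; integrable M u; weak_upper_gradient M p u g\<rbrakk> \<Longrightarrow>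
        nn_average M (ball x r) (\<lambda>y. ennreal \<bar>u y - average M (ball x r) u\<bar>)
          \<le> ennreal (C0 * diameter (ball x r)) *
            epowr (nn_average M (ball x (\<sigma> * r)) (\<lambda>y. epowr (g y) p)) (1 / p)"
    using assms(4) unfolding supports_poincare_def by blast
  define N where "N = density M (\<lambda>x. epowr (g x) p)"
  \<comment> \<open>Decay passes to the larger order since \<open>r / R \<le> 1\<close>.\<close>
  have volume: "volume_decay_space M c Q'"
  proof
    show pos: "0 < measure M (ball x r)" if "0 < r" for x r
      using balls[OF that, of x] by (simp add: M.emeasure_eq_measure)
    show "c * (r / R) powr Q' * measure M (ball x R) \<le> measure M (ball y r)"
      if "dist x y < R" "0 < r" "r \<le> R" for x y r R
    proof -
      have R: "0 < measure M (ball x R)" using that by (intro pos) auto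
      have "(r / R) powr Q' \<le> (r / R) powr Q"
        using that Q'(1) by (intro powr_mono') auto
      then have "c * (r / R) powr Q' \<le> c * (r / R) powr Q" using c(1) by simp
      also have "\<dots> \<le> measure M (ball y r) / measure M (ball x R)" using that by (intro c(2)) auto
      finally show ?thesis using R by (simp add: field_simps)
    qed
  qed (use assms(5) Q'(1) c(1) space_M borel in auto)
  have finN: "finite_measure N"
  proof (rule finite_measureI)
    have "emeasure N (space N) = (\<integral>\<^sup>+x. epowr (g x) p \<partial>M)"
      unfolding N_def by (subst emeasure_density) (auto intro!: nn_integral_cong)
    then show "emeasure N (space N) \<noteq> \<infinity>" using gfin by simp
  qed
  have setting: "poincare_setting M N c Q' p \<sigma> (2 * C0)"
  proof (intro poincare_setting.intro volume finN poincare_setting_axioms.intro)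
    show "sets N = sets M" by (simp add: N_def)
    show "measure M A \<le> measure N A" if A: "A \<in> sets M" for A
    proof -
      have "emeasure M A = (\<integral>\<^sup>+x\<in>A. 1 \<partial>M)" using A by simp
      also have "\<dots> \<le> (\<integral>\<^sup>+x\<in>A. epowr (g x) p \<partial>M)"
        unfolding g_def using assms(3) by (intro nn_integral_mono mult_right_mono one_le_epowr_add_one) auto
      also have "\<dots> = emeasure N A" unfolding N_def using A by (subst emeasure_density) auto
      finally show ?thesis
        by (simp add: M.emeasure_eq_measure finite_measure.emeasure_eq_measure[OF finN])
    qed
  qed (use assms(3) Q'(2) C0 in auto)
  note pair = poincare_setting_truncation[OF setting assms(1) N_def upper_gradient_borel[OF g] gfin refl PI]
  have v_int: "integrable M v"
  proof (rule integrableI_bounded)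
    have "(\<integral>\<^sup>+x. ennreal (norm (v x)) \<partial>M) \<le> (\<integral>\<^sup>+x. 1 + ennreal (\<bar>v x\<bar> powr p) \<partial>M)"
    proof (rule nn_integral_mono)
      fix x
      have "\<bar>v x\<bar> \<le> 1 + \<bar>v x\<bar> powr p"
      proof (cases "\<bar>v x\<bar> \<le> 1")
        case False
        then have "\<bar>v x\<bar> powr 1 \<le> \<bar>v x\<bar> powr p" using assms(3) by (intro powr_mono) auto
        then show ?thesis using False by simp
      qed (simp add: add_increasing2)
      then show "ennreal (norm (v x)) \<le> 1 + ennreal (\<bar>v x\<bar> powr p)"
        by (simp add: ennreal_leI flip: ennreal_plus ennreal_1)
    qed
    also have "\<dots> = emeasure M (space M) + (\<integral>\<^sup>+x. ennreal (\<bar>v x\<bar> powr p) \<partial>M)"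
      by (subst nn_integral_add) auto
    also have "\<dots> < \<infinity>" using vp assms(12) by (simp add: space_M)
    finally show "(\<integral>\<^sup>+x. ennreal (norm (v x)) \<partial>M) < \<infinity>" .
  qed simp
  interpret sobolev_function M N c Q' p \<sigma> "2 * C0" v
  proof (intro sobolev_function.intro setting sobolev_function_axioms.intro)
    show "poincare_setting.poincare_pair M N p \<sigma> (2 * C0) v UNIV"
    proof (rule pair)
      show "weak_upper_gradient M p v (\<lambda>x. g x * indicator A' x)" if "UNIV \<subseteq> A'" for A'
        using that upper_gradient_imp_weak[OF g] assms(3) by (simp add: top.extremum_unique)
    qed (use v_int space_M sets.top[of M] in auto)
    fix a t :: real assume t: "0 < t"
    show "poincare_setting.poincare_pair M N p \<sigma> (2 * C0)
        (\<lambda>x. min (max (\<bar>v x - a\<bar> - t) 0) t) {x. t < \<bar>v x - a\<bar> \<and> \<bar>v x - a\<bar> < 2 * t}"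
    proof (rule pair)
      show "integrable M (\<lambda>x. min (max (\<bar>v x - a\<bar> - t) 0) t)"
        using t by (intro M.integrable_const_bound[where B = t]) auto
      have "{x \<in> space M. t < \<bar>v x - a\<bar> \<and> \<bar>v x - a\<bar> < 2 * t} \<in> sets M" by measurable
      then show "{x. t < \<bar>v x - a\<bar> \<and> \<bar>v x - a\<bar> < 2 * t} \<in> sets M" by (simp add: space_M)
      show "weak_upper_gradient M p (\<lambda>x. min (max (\<bar>v x - a\<bar> - t) 0) t) (\<lambda>x. g x * indicator A' x)"
        if "A' \<in> sets borel" "{x. t < \<bar>v x - a\<bar> \<and> \<bar>v x - a\<bar> < 2 * t} \<subseteq> A'" for A'
        by (rule weak_upper_gradient_truncation[OF g gfin that t])
    qed
  qed
  have ae: "AE x in M. u x = ereal (v x)"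
    using AE_lebesgue_point
    by eventually_elim
       (simp add: assms(10) limsup_averages_lebesgue_point lebesgue_point_tendsto)
  \<comment> \<open>Only the integrated values of \<open>u\<close> are replaced here, which is
    allowed for every \<open>x\<close>. The value \<open>u x\<close> at the centre needs
    \<open>x\<close> outside the exceptional null set and is exchanged under the outer
    integral.\<close>
  have avg: "nn_average M (ball x r) (\<lambda>y. epowr (e2ennreal \<bar>u y - ereal (v x)\<bar>) h)
      = nn_average M (ball x r) (\<lambda>y. ennreal (\<bar>v y - v x\<bar> powr h))" for x r
    unfolding nn_average_def
    using ae
    by (intro arg_cong2[where f = "(/)"] nn_integral_cong_AE refl)
       (auto elim!: eventually_mono simp: epowr_ennreal)
  have "(\<integral>\<^sup>+x. epowr
            (\<integral>\<^sup>+r\<in>{0<..<\<delta>}.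
               epowr (nn_average M (ball x r) (\<lambda>y. epowr (e2ennreal \<bar>u y - u x\<bar>) h))
                     (p / (h * (p - 1))) * ennreal (1 / r) \<partial>lborel)
            (p - 1) \<partial>M) =
        (\<integral>\<^sup>+x. epowr
            (\<integral>\<^sup>+r\<in>{0<..<\<delta>}.
               epowr (nn_average M (ball x r) (\<lambda>y. ennreal (\<bar>v y - v x\<bar> powr h)))
                     (p / (h * (p - 1))) * ennreal (1 / r) \<partial>lborel)
            (p - 1) \<partial>M)"
    using ae by (intro nn_integral_cong_AE) (erule eventually_mono, simp only: avg)
  also have "\<dots> < \<infinity>"
    using h Q'(3) assms(7) by (intro oscillation_integral_finite) (auto simp: q_def)
  finally show ?thesis .
qed

end
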